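(* Let $L:S\mathcal E(\mu)\times[0,1]\to\mathbb R$ be a smooth Lagrangian, and for smooth curves $q:[0,1]\to\mathcal E(\mu)$ let $$A(q)=\int_0^1 L(q(t),\overset{\star}{q}(t),t)\,dt$$ be the action integral. If $q$ is an extremal of the action integral, then $$\frac{D}{dt}\,\mathrm{Grad}_{e}L(q(t),\overset{\star}{q}(t),t)=\mathrm{Grad}\,L(q(t),\overset{\star}{q}(t),t),\qquad t\in[0,1],$$ where $\frac{D}{dt}$ is the mixture covariant derivative.
   Context: $\Omega$ is a finite set with $N$ elements and $\mu$ is the uniform probability on $\Omega$. $\mathcal E(\mu)$ is the set of strictly positive probability densities with respect to $\mu$, i.e. functions $q:\Omega\to(0,\infty)$ with $\sum_{x}q(x)=N$. For $f:\Omega\to\mathbb R$, $\mathbb E_q[f]=\frac1N\sum_x f(x)q(x)$. For $q\in\mathcal E(\mu)$ the exponential fiber $S_q\mathcal E(\mu)$ and the mixture fiber ${}^*S_q\mathcal E(\mu)$ are both equal, as vector spaces, to $\{v:\Omega\to\mathbb R : \mathbb E_q[v]=0\}$, with duality pairing $\langle\eta,v\rangle_q=\mathbb E_q[\eta v]$ for $\eta\in{}^*S_q\mathcal E(\mu)$, $v\in S_q\mathcal E(\mu)$. The statistical bundle is $S\mathcal E(\mu)=\{(q,w):q\in\mathcal E(\mu),w\in S_q\mathcal E(\mu)\}$, with the manifold structure induced from its embedding in $\mathbb R^{2N}$. The exponential transport is ${}^{e}\mathbb U_p^q v=v-\mathbb E_q[v]$ from $S_p\mathcal E(\mu)$ to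 $S_q\mathcal E(\mu)$. For $p\in\mathcal E(\mu)$ and $u\in S_p\mathcal E(\mu)$, $K_p(u)=\log\mathbb E_p[e^u]$ and $e_p(u)=e^{u-K_p(u)}\,p$; $e_p$ is a bijection $S_p\mathcal E(\mu)\to\mathcal E(\mu)$. A dot denotes the ordinary time derivative. The velocity of a smooth curve $q(t)$ in $\mathcal E(\mu)$ is $\overset{\star}{q}(t)=\frac{d}{dt}\log q(t)=\dot q(t)/q(t)\in S_{q(t)}\mathcal E(\mu)$. The mixture covariant derivative of $\eta(t)\in{}^*S_{q(t)}\mathcal E(\mu)$ along $q(t)$ is $\frac{D}{dt}\eta=\overset{\star}{q}\,\eta+\dot\eta$. Gradients of $L$: the fiber gradient $\mathrm{Grad}_{e}L(q,w,t)\in{}^*S_q\mathcal E(\mu)$ is defined by $\frac{d}{ds}L(q,w+s\beta,t)|_{s=0}=\langle\mathrm{Grad}_{e}L(q,w,t),\beta\rangle_q$ for all $\beta\in S_q\mathcal E(\mu)$. The gradient $\mathrm{Grad}\,L(q,w,t)\in{}^*S_q\mathcal E(\mu)$ is the natural gradient with the fiber variable transported: for any $p$, with $L_p(u,v,t)=L(e_p(u),{}^{e}\mathbb U_p^{e_p(u)}v,t)$, $q=e_p(u)$, $w={}^{e}\mathbb U_p^q v$, it satisfies $\langle\mathrm{Grad}\,L(q,w,t),h\rangle_q=D_1L_p(u,v,t)[{}^{e}\mathbb U_q^p h]$ for all $h\in S_q\mathcal E(\mu)$, where $D_1$ is the differential in the first variable $u$. Extremal of the action has the usual meaning of the calculus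 of variations: the first derivative of $A$ vanishes along every smooth variation of $q$ with fixed endpoints. *)

theory Defs
  imports "HOL-Analysis.Analysis"
begin

text \<open>The finite sample space is the index type \<open>'n\<close>, so \<open>N = CARD('n)\<close>, and functions
  on it are vectors in \<open>real ^ 'n\<close>, whose product \<open>*\<close> is pointwise.\<close>

section \<open>Smooth maps on subsets of normed spaces\<close>

text \<open>Intended for open \<open>U\<close> in a finite-dimensional space, where continuity of all iterated
  directional derivatives up to order \<open>k\<close> is the usual notion of \<open>C\<^sup>k\<close>.\<close>

primrec Ck_on :: "nat \<Rightarrow> ('a::real_normed_vector \<Rightarrow> 'b::real_normed_vector) \<Rightarrow> 'a set \<Rightarrow> bool" where
  "Ck_on 0 f U \<longleftrightarrow> continuous_on U f"
| "Ck_on (Suc k) f U \<longleftrightarrow>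
     (\<forall>x\<in>U. f differentiable (at x)) \<and> (\<forall>v. Ck_on k (\<lambda>x. frechet_derivative f (at x) v) U)"

text \<open>Smoothness on an arbitrary subset \<open>S\<close>, by local smooth extension. On an embedded
  submanifold, possibly with boundary (such as a curve parameter in \<open>[0, 1]\<close>), this is smoothness
  with respect to the induced manifold structure.\<close>

definition smooth_map_on :: "'a::real_normed_vector set \<Rightarrow> ('a \<Rightarrow> 'b::real_normed_vector) \<Rightarrow> bool" where
  "smooth_map_on S f \<longleftrightarrow>
     (\<forall>x\<in>S. \<exists>U F. open U \<and> x \<in> U \<and> (\<forall>k. Ck_on k F U) \<and> (\<forall>y\<in>S \<inter> U. F y = f y))"

section \<open>The statistical bundle\<close>

definition densities :: "(real ^ 'n::finite) set" where
  "densities = {q. (\<forall>x. 0 < q $ x) \<and> (\<Sum>x\<in>UNIV. q $ x) = real CARD('n)}"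

definition mean :: "real ^ 'n::finite \<Rightarrow> real ^ 'n \<Rightarrow> real" where
  "mean q f = (\<Sum>x\<in>UNIV. f $ x * q $ x) / real CARD('n)"

text \<open>The exponential and the mixture fiber at \<open>q\<close> are the same vector space.\<close>

definition fiber :: "real ^ 'n::finite \<Rightarrow> (real ^ 'n) set" where
  "fiber q = {v. mean q v = 0}"

definition pairing :: "real ^ 'n::finite \<Rightarrow> real ^ 'n \<Rightarrow> real ^ 'n \<Rightarrow> real" where
  "pairing q \<eta> v = mean q (\<eta> * v)"

definition stat_bundle :: "((real ^ 'n::finite) \<times> (real ^ 'n)) set" where
  "stat_bundle = {(q, w). q \<in> densities \<and> w \<in> fiber q}"

definition exp_transport :: "real ^ 'n::finite \<Rightarrow> real ^ 'n \<Rightarrow> real ^ 'n \<Rightarrow> real ^ 'n" where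
  "exp_transport p q v = (\<chi> x. v $ x - mean q v)"

definition cumulant :: "real ^ 'n::finite \<Rightarrow> real ^ 'n \<Rightarrow> real" where
  "cumulant p u = ln (mean p (\<chi> x. exp (u $ x)))"

definition exp_chart_inv :: "real ^ 'n::finite \<Rightarrow> real ^ 'n \<Rightarrow> real ^ 'n" where
  "exp_chart_inv p u = (\<chi> x. exp (u $ x - cumulant p u) * p $ x)"

section \<open>Velocity and mixture covariant derivative\<close>

text \<open>Curves are functions on \<open>real\<close> of which only the values on \<open>[0, 1]\<close> matter; time
  derivatives are taken within \<open>[0, 1]\<close>, hence one-sided at the end points.\<close>

definition velocity :: "(real \<Rightarrow> real ^ 'n::finite) \<Rightarrow> real \<Rightarrow> real ^ 'n" where
  "velocity q t = vector_derivative (\<lambda>s. \<chi> x. ln (q s $ x)) (at t within {0..1})"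

definition mix_cov_deriv ::
    "(real \<Rightarrow> real ^ 'n::finite) \<Rightarrow> (real \<Rightarrow> real ^ 'n) \<Rightarrow> real \<Rightarrow> real ^ 'n" where
  "mix_cov_deriv q \<eta> t = velocity q t * \<eta> t + vector_derivative \<eta> (at t within {0..1})"

section \<open>Lagrangians and their gradients\<close>

type_synonym 'n lagrangian = "real ^ 'n \<Rightarrow> real ^ 'n \<Rightarrow> real \<Rightarrow> real"

definition smooth_lagrangian :: "'n::finite lagrangian \<Rightarrow> bool" where
  "smooth_lagrangian L \<longleftrightarrow>
     smooth_map_on (stat_bundle \<times> {0..1}) (\<lambda>((q, w), t). L q w t)"

definition fiber_grad ::
    "'n::finite lagrangian \<Rightarrow> real ^ 'n \<Rightarrow> real ^ 'n \<Rightarrow> real \<Rightarrow> real ^ 'n" where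
  "fiber_grad L q w t =
     (THE g. g \<in> fiber q \<and>
        (\<forall>\<beta>\<in>fiber q. ((\<lambda>s. L q (w + s *\<^sub>R \<beta>) t) has_real_derivative pairing q g \<beta>) (at 0)))"

text \<open>The Lagrangian read in the exponential chart centred at \<open>p\<close>.\<close>

definition chart_lagrangian :: "'n::finite lagrangian \<Rightarrow> real ^ 'n \<Rightarrow> 'n lagrangian" where
  "chart_lagrangian L p u v t =
     L (exp_chart_inv p u) (exp_transport p (exp_chart_inv p u) v) t"

text \<open>The differential \<open>D\<close> in the first variable is that of a function on the vector space
  \<open>fiber p\<close>. As a map on the ambient space it is determined only on \<open>fiber p\<close>, where alone it
  is evaluated.\<close>

definition nat_grad ::
    "'n::finite lagrangian \<Rightarrow> real ^ 'n \<Rightarrow> real ^ 'n \<Rightarrow> real \<Rightarrow> real ^ 'n" where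
  "nat_grad L q w t =
     (THE g. g \<in> fiber q \<and>
        (\<forall>p\<in>densities. \<forall>u\<in>fiber p. \<forall>v\<in>fiber p.
           exp_chart_inv p u = q \<and> exp_transport p q v = w \<longrightarrow>
           (\<exists>D. ((\<lambda>u'. chart_lagrangian L p u' v t) has_derivative D) (at u within fiber p) \<and>
                (\<forall>h\<in>fiber q. pairing q g h = D (exp_transport q p h)))))"

section \<open>Action and extremals\<close>

definition smooth_curve :: "(real \<Rightarrow> real ^ 'n::finite) \<Rightarrow> bool" where
  "smooth_curve q \<longleftrightarrow> smooth_map_on {0..1} q \<and> (\<forall>t\<in>{0..1}. q t \<in> densities)"

definition action :: "'n::finite lagrangian \<Rightarrow> (real \<Rightarrow> real ^ 'n) \<Rightarrow> real" where
  "action L q = integral {0..1} (\<lambda>t. L (q t) (velocity q t) t)"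

definition smooth_variation ::
    "real \<Rightarrow> (real \<Rightarrow> real \<Rightarrow> real ^ 'n::finite) \<Rightarrow> (real \<Rightarrow> real ^ 'n) \<Rightarrow> bool" where
  "smooth_variation \<epsilon> H q \<longleftrightarrow>
     smooth_map_on ({-\<epsilon><..<\<epsilon>} \<times> {0..1}) (\<lambda>(s, t). H s t) \<and>
     (\<forall>s\<in>{-\<epsilon><..<\<epsilon>}. \<forall>t\<in>{0..1}. H s t \<in> densities) \<and>
     (\<forall>t\<in>{0..1}. H 0 t = q t) \<and>
     (\<forall>s\<in>{-\<epsilon><..<\<epsilon>}. H s 0 = q 0 \<and> H s 1 = q 1)"

definition extremal :: "'n::finite lagrangian \<Rightarrow> (real \<Rightarrow> real ^ 'n) \<Rightarrow> bool" where
  "extremal L q \<longleftrightarrow>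
     (\<forall>\<epsilon>>0. \<forall>H. smooth_variation \<epsilon> H q \<longrightarrow>
        ((\<lambda>s. action L (H s)) has_real_derivative 0) (at 0))"

end

theory Submission
  imports Defs
begin

text \<open>A tangent vector \<open>(q', w')\<close> of the statistical bundle at \<open>(q, w)\<close> is a pair of elements of the
  fiber: the score \<open>h = q' / q\<close> and the vertical part \<open>\<beta> = w' + E[w h]\<close>, the correction being the
  derivative of the exponential transport. In this splitting the differential of the Lagrangian is
  \<open>\<langle>Grad L, h\<rangle> + \<langle>Grad\<^sub>e L, \<beta>\<rangle>\<close> (\<open>lagrangian_chain_rule\<close>). The two gradients are thus the components
  of one differential, whatever smooth extension of the Lagrangian to the ambient space or
  exponential chart is used to compute it, and they are continuous on the bundle
  (\<open>continuous_on_gradients\<close>).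

  For a function \<open>a\<close> and a polynomial \<open>\<phi>\<close> with \<open>\<phi>(0) = \<phi>(1) = 0\<close>, the extremal \<open>q\<close> is varied with
  score \<open>h = \<phi> (a - E[a])\<close>. The vertical part of the variation of \<open>(q, v)\<close>, with \<open>v\<close> the velocity of
  \<open>q\<close>, is then \<open>\<phi>' (a - E[a])\<close>, and differentiation under the integral yields
  \<open>\<integral> \<phi> \<langle>Grad L, a\<rangle> + \<phi>' \<langle>Grad\<^sub>e L, a\<rangle> dt = 0\<close> (\<open>euler_lagrange_weak\<close>). The du Bois-Reymond lemma
  (\<open>weak_derivative_imp_derivative\<close>) turns this into \<open>d/dt \<langle>Grad\<^sub>e L, a\<rangle> = \<langle>Grad L, a\<rangle>\<close>. With \<open>a\<close> the
  indicator of a point and \<open>\<eta> = Grad\<^sub>e L\<close>, this reads \<open>(\<eta> q)' = q Grad L\<close>, and division by \<open>q\<close> gives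
  \<open>\<eta>' + v \<eta> = Grad L\<close>, whose left side is the mixture covariant derivative.\<close>

section \<open>Calculus of smooth maps\<close>

text \<open>Extensions of smooth maps are only given near each point, so continuity is always
  obtained on a neighbourhood first.\<close>

lemma continuous_on_locally:
  fixes f :: "'a::t2_space \<Rightarrow> 'b::topological_space"
  assumes "\<And>x. x \<in> S \<Longrightarrow> \<exists>U. open U \<and> x \<in> U \<and> continuous_on (S \<inter> U) f"
  shows "continuous_on S f"
  unfolding continuous_on_eq_continuous_within
proof (rule ballI)
  fix x assume x: "x \<in> S"
  then obtain U where U: "open U" "x \<in> U" "continuous_on (S \<inter> U) f" using assms by blast
  then have "continuous (at x within S \<inter> U) f"
    using x by (simp add: continuous_on_eq_continuous_within)
  moreover have "at x within S \<inter> U = at x within S"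
    by (rule at_within_nhd[OF U(2,1)]) auto
  ultimately show "continuous (at x within S) f" by simp
qed

lemma Ck_on_subset: "Ck_on k f U \<Longrightarrow> V \<subseteq> U \<Longrightarrow> Ck_on k f V"
  by (induction k arbitrary: f) (auto intro: continuous_on_subset)

text \<open>The iterated derivatives are ambient derivatives, so openness of the set is what makes
  them depend only on the values there.\<close>

lemma Ck_on_cong:
  assumes "open U" "\<And>x. x \<in> U \<Longrightarrow> f x = g x" "Ck_on k f U"
  shows "Ck_on k g U"
  using assms(2,3)
proof (induction k arbitrary: f g)
  case 0
  then show ?case using continuous_on_cong by force
next
  case (Suc k)
  have diff: "g differentiable (at x)" and
    deriv: "frechet_derivative f (at x) = frechet_derivative g (at x)" if x: "x \<in> U" for x
  proof -
    have "(f has_derivative frechet_derivative f (at x)) (at x)"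
      using Suc.prems x by (simp add: frechet_derivative_works)
    then have "(g has_derivative frechet_derivative f (at x)) (at x)"
      by (rule has_derivative_transform_within_open[OF _ assms(1) x]) (use Suc.prems in auto)
    then show "g differentiable (at x)"
      "frechet_derivative f (at x) = frechet_derivative g (at x)"
      by (auto intro: differentiableI frechet_derivative_at)
  qed
  have "Ck_on k (\<lambda>x. frechet_derivative g (at x) v) U" for v
    by (rule Suc.IH[of "\<lambda>x. frechet_derivative f (at x) v"]) (use Suc.prems deriv in auto)
  then show ?case using diff by auto
qed

lemma Ck_on_continuous: "Ck_on k f U \<Longrightarrow> continuous_on U f"
  by (cases k) (auto intro: continuous_at_imp_continuous_on differentiable_imp_continuous_within)

lemma Ck_on_SucD: "Ck_on (Suc k) f U \<Longrightarrow> Ck_on k f U"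
proof (induction k arbitrary: f)
  case 0
  then have "continuous_on U f" by (rule Ck_on_continuous)
  then show ?case by simp
next
  case (Suc k)
  have "Ck_on k (\<lambda>x. frechet_derivative f (at x) v) U" for v
    by (rule Suc.IH) (use Suc.prems in simp)
  then show ?case using Suc.prems by simp
qed

text \<open>\<open>frechet_derivative\<close> is a choice that must be computed before it can be differentiated
  again. Any explicit formula for the derivative on the open set serves, so closure properties are
  inductions on the order through this rule.\<close>

lemma Ck_on_SucI:
  assumes "open U" "\<And>x. x \<in> U \<Longrightarrow> (f has_derivative f' x) (at x)"
    and "\<And>v. Ck_on k (\<lambda>x. f' x v) U"
  shows "Ck_on (Suc k) f U"
proof -
  have "Ck_on k (\<lambda>x. frechet_derivative f (at x) v) U" for v
    by (rule Ck_on_cong[OF assms(1) _ assms(3)[of v]])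
      (use assms(2) frechet_derivative_at in force)
  then show ?thesis using assms(2) by (auto intro: differentiableI)
qed

lemma Ck_on_Suc_derivative:
  assumes "Ck_on (Suc k) f U"
  shows "x \<in> U \<Longrightarrow> (f has_derivative frechet_derivative f (at x)) (at x)"
    and "Ck_on k (\<lambda>x. frechet_derivative f (at x) v) U"
  using assms by (simp_all add: frechet_derivative_works)

lemma Ck_on_const: "open U \<Longrightarrow> Ck_on k (\<lambda>x. c) U"
proof (induction k arbitrary: c)
  case (Suc k)
  then show ?case by (intro Ck_on_SucI[where f' = "\<lambda>x v. 0"]) auto
qed simp

lemma Ck_on_bounded_linear:
  assumes "open U" "bounded_linear f"
  shows "Ck_on k f U"
proof (cases k)
  case 0
  then show ?thesis using assms by (simp add: linear_continuous_on)
next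
  case (Suc m)
  have "Ck_on (Suc m) f U"
    using assms
    by (intro Ck_on_SucI[where f' = "\<lambda>x. f"] Ck_on_const bounded_linear_imp_has_derivative)
  then show ?thesis using Suc by simp
qed

lemma Ck_on_add:
  assumes "open U" "Ck_on k f U" "Ck_on k g U"
  shows "Ck_on k (\<lambda>x. f x + g x) U"
  using assms(2,3)
proof (induction k arbitrary: f g)
  case 0
  then show ?case by (auto intro: continuous_on_add)
next
  case (Suc k)
  let ?f' = "\<lambda>x. frechet_derivative f (at x)"
  let ?g' = "\<lambda>x. frechet_derivative g (at x)"
  note D = Suc.prems[THEN Ck_on_Suc_derivative(1)] Suc.prems[THEN Ck_on_Suc_derivative(2)]
  show ?case
    by (intro Ck_on_SucI[where f' = "\<lambda>x v. ?f' x v + ?g' x v"] has_derivative_add Suc.IH assms(1) D) auto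
qed

text \<open>The Leibniz rule expresses each derivative by products of maps that are one order less
  smooth, the undifferentiated factor being smooth enough by \<open>Ck_on_SucD\<close>.\<close>

lemma Ck_on_bilinear:
  assumes "open U" "bounded_bilinear m" "Ck_on k f U" "Ck_on k g U"
  shows "Ck_on k (\<lambda>x. m (f x) (g x)) U"
  using assms(3,4)
proof (induction k arbitrary: f g)
  case 0
  then show ?case using bounded_bilinear.continuous_on[OF assms(2)] by auto
next
  case (Suc k)
  note low = Suc.prems[THEN Ck_on_SucD]
  let ?f' = "\<lambda>x. frechet_derivative f (at x)"
  let ?g' = "\<lambda>x. frechet_derivative g (at x)"
  note D = Suc.prems[THEN Ck_on_Suc_derivative(1)] Suc.prems[THEN Ck_on_Suc_derivative(2)]
  show ?case
  proof (rule Ck_on_SucI[where f' = "\<lambda>x v. m (f x) (?g' x v) + m (?f' x v) (g x)"])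
    show "((\<lambda>x. m (f x) (g x)) has_derivative
        (\<lambda>v. m (f x) (?g' x v) + m (?f' x v) (g x))) (at x)" if "x \<in> U" for x
      using that by (intro bounded_bilinear.FDERIV[OF assms(2)] D)
    show "Ck_on k (\<lambda>x. m (f x) (?g' x v) + m (?f' x v) (g x)) U" for v
      by (rule Ck_on_add[OF assms(1) Suc.IH[OF low(1) D(4)] Suc.IH[OF D(3) low(2)]])
  qed (rule assms(1))
qed

lemma Ck_on_compose_linear:
  assumes l: "bounded_linear l" and U: "open U" and f: "Ck_on k f U"
  shows "Ck_on k (\<lambda>x. f (l x)) (l -` U)"
  using f
proof (induction k arbitrary: f)
  case 0
  then show ?case
    by (auto intro!: continuous_on_compose2[of U f] linear_continuous_on[OF l])
next
  case (Suc k)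
  have V: "open (l -` U)"
    using U l by (auto intro!: open_vimage linear_continuous_on)
  let ?f' = "\<lambda>x. frechet_derivative f (at x)"
  note D = Suc.prems[THEN Ck_on_Suc_derivative(1)] Suc.prems[THEN Ck_on_Suc_derivative(2)]
  show ?case
    by (intro Ck_on_SucI[where f' = "\<lambda>x v. ?f' (l x) (l v)"] V
        has_derivative_compose[OF bounded_linear_imp_has_derivative[OF l]] Suc.IH D) auto
qed

lemma smooth_map_onE:
  assumes "smooth_map_on S f" "x \<in> S"
  obtains U F where "open U" "x \<in> U" "\<And>k. Ck_on k F U" "\<And>y. y \<in> S \<inter> U \<Longrightarrow> F y = f y"
  using assms unfolding smooth_map_on_def by metis

lemma smooth_map_on_linear: "bounded_linear f \<Longrightarrow> smooth_map_on S f"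
  unfolding smooth_map_on_def using Ck_on_bounded_linear by (metis UNIV_I open_UNIV)

lemma smooth_map_on_const: "smooth_map_on S (\<lambda>x. c)"
  unfolding smooth_map_on_def using Ck_on_const by (metis UNIV_I open_UNIV)

lemma smooth_map_on_bilinear:
  assumes m: "bounded_bilinear m" and "smooth_map_on S f" "smooth_map_on S g"
  shows "smooth_map_on S (\<lambda>x. m (f x) (g x))"
  unfolding smooth_map_on_def
proof
  fix x assume x: "x \<in> S"
  obtain U F where F: "open U" "x \<in> U" "\<And>k. Ck_on k F U" "\<And>y. y \<in> S \<inter> U \<Longrightarrow> F y = f y"
    using smooth_map_onE[OF assms(2) x] by metis
  obtain V G where G: "open V" "x \<in> V" "\<And>k. Ck_on k G V" "\<And>y. y \<in> S \<inter> V \<Longrightarrow> G y = g y"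
    using smooth_map_onE[OF assms(3) x] by metis
  have "Ck_on k (\<lambda>x. m (F x) (G x)) (U \<inter> V)" for k
    by (rule Ck_on_bilinear) (use m F(1,3) G(1,3) in \<open>auto intro: Ck_on_subset\<close>)
  then show "\<exists>U F. open U \<and> x \<in> U \<and> (\<forall>k. Ck_on k F U) \<and> (\<forall>y\<in>S \<inter> U. F y = m (f y) (g y))"
    using F G by (intro exI[of _ "U \<inter> V"] exI[of _ "\<lambda>x. m (F x) (G x)"]) auto
qed

lemma smooth_map_on_add:
  assumes "smooth_map_on S f" "smooth_map_on S g"
  shows "smooth_map_on S (\<lambda>x. f x + g x)"
  unfolding smooth_map_on_def
proof
  fix x assume x: "x \<in> S"
  obtain U F where F: "open U" "x \<in> U" "\<And>k. Ck_on k F U" "\<And>y. y \<in> S \<inter> U \<Longrightarrow> F y = f y"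
    using smooth_map_onE[OF assms(1) x] by metis
  obtain V G where G: "open V" "x \<in> V" "\<And>k. Ck_on k G V" "\<And>y. y \<in> S \<inter> V \<Longrightarrow> G y = g y"
    using smooth_map_onE[OF assms(2) x] by metis
  have "Ck_on k (\<lambda>x. F x + G x) (U \<inter> V)" for k
    by (rule Ck_on_add) (use F(1,3) G(1,3) in \<open>auto intro: Ck_on_subset\<close>)
  then show "\<exists>U F. open U \<and> x \<in> U \<and> (\<forall>k. Ck_on k F U) \<and> (\<forall>y\<in>S \<inter> U. F y = f y + g y)"
    using F G by (intro exI[of _ "U \<inter> V"] exI[of _ "\<lambda>x. F x + G x"]) auto
qed

lemma smooth_map_on_compose_linear:
  assumes l: "bounded_linear l" and f: "smooth_map_on S f" and "l ` T \<subseteq> S"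
  shows "smooth_map_on T (\<lambda>x. f (l x))"
  unfolding smooth_map_on_def
proof
  fix x assume x: "x \<in> T"
  then obtain U F where F: "open U" "l x \<in> U" "\<And>k. Ck_on k F U" "\<And>y. y \<in> S \<inter> U \<Longrightarrow> F y = f y"
    using smooth_map_onE[OF f, of "l x"] assms(3) by (metis image_subset_iff)
  have "open (l -` U)"
    using F l by (auto intro!: open_vimage linear_continuous_on)
  then show "\<exists>U F. open U \<and> x \<in> U \<and> (\<forall>k. Ck_on k F U) \<and> (\<forall>y\<in>T \<inter> U. F y = f (l y))"
    using F assms(3) Ck_on_compose_linear[OF l F(1) F(3)]
    by (intro exI[of _ "l -` U"] exI[of _ "\<lambda>x. F (l x)"]) auto
qed

lemma smooth_map_on_polynomial:
  "real_polynomial_function \<phi> \<Longrightarrow> smooth_map_on S \<phi>"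
  by (induction rule: real_polynomial_function.induct)
    (auto intro: smooth_map_on_linear smooth_map_on_const smooth_map_on_add
      smooth_map_on_bilinear[OF bounded_bilinear_mult])

lemma smooth_map_on_continuous_on:
  assumes "smooth_map_on S f"
  shows "continuous_on S f"
proof -
  have "\<exists>U. open U \<and> x \<in> U \<and> continuous_on (S \<inter> U) f" if x: "x \<in> S" for x
  proof -
    obtain U F where F: "open U" "x \<in> U" "\<And>k. Ck_on k F U" "\<And>y. y \<in> S \<inter> U \<Longrightarrow> F y = f y"
      using smooth_map_onE[OF assms x] by metis
    then have "continuous_on (S \<inter> U) F" using Ck_on_continuous continuous_on_subset by blast
    then have "continuous_on (S \<inter> U) f" by (rule continuous_on_eq) (use F in auto)
    then show ?thesis using F by blast
  qed
  then show ?thesis by (rule continuous_on_locally)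
qed

lemma smooth_curve_has_vector_derivative:
  fixes f :: "real \<Rightarrow> 'a::real_normed_vector"
  assumes "smooth_map_on {0..1} f"
  obtains f' where
    "\<And>t. t \<in> {0..1} \<Longrightarrow> (f has_vector_derivative f' t) (at t within {0..1})"
    "continuous_on {0..1} f'"
proof -
  let ?I = "{0..1::real}"
  have loc: "\<exists>U g. open U \<and> t \<in> U \<and> continuous_on U g \<and>
    (\<forall>s\<in>?I \<inter> U. (f has_vector_derivative g s) (at s within ?I))" if t: "t \<in> ?I" for t
  proof -
    obtain U F where F: "open U" "t \<in> U" "\<And>k. Ck_on k F U" "\<And>y. y \<in> ?I \<inter> U \<Longrightarrow> F y = f y"
      using smooth_map_onE[OF assms t] by metis
    let ?F' = "\<lambda>x. frechet_derivative F (at x)"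
    note F' = Ck_on_Suc_derivative[OF F(3)[of "Suc 0"]]
    have "(f has_vector_derivative ?F' s 1) (at s within ?I)" if s: "s \<in> ?I \<inter> U" for s
    proof -
      have "(F has_vector_derivative ?F' s 1) (at s)"
      proof -
        have D: "(F has_derivative ?F' s) (at s)" using F'(1) s by blast
        have "?F' s = (\<lambda>x. x *\<^sub>R ?F' s 1)"
          using linear_scale[OF has_derivative_linear[OF D], of _ 1] by (intro ext) (metis mult.right_neutral real_scaleR_def)
        then show ?thesis using D unfolding has_vector_derivative_def by metis
      qed
      then have "(F has_vector_derivative ?F' s 1) (at s within ?I \<inter> U)"
        by (rule has_vector_derivative_at_within)
      then have "(f has_vector_derivative ?F' s 1) (at s within ?I \<inter> U)"
        by (rule has_vector_derivative_transform[OF s, rotated]) (use F in auto)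
      moreover have "at s within ?I \<inter> U = at s within ?I"
        by (rule at_within_nhd[of s U]) (use F(1) s in auto)
      ultimately show ?thesis by simp
    qed
    then show ?thesis using F(1,2) F'(2)[of 1] by (intro exI[of _ U] exI[of _ "\<lambda>s. ?F' s 1"]) auto
  qed
  define f' where "f' = (\<lambda>t. vector_derivative f (at t within ?I))"
  have eq: "f' s = d" if "(f has_vector_derivative d) (at s within ?I)" "s \<in> ?I" for s d
    using that unfolding f'_def by (auto intro: vector_derivative_within_cbox[of 0 1, simplified])
  have d: "(f has_vector_derivative f' t) (at t within ?I)" if t: "t \<in> ?I" for t
  proof -
    obtain d where "(f has_vector_derivative d) (at t within ?I)"
      using loc[OF t] t by blast
    then show ?thesis using eq t by metis
  qed
  have "\<exists>U. open U \<and> t \<in> U \<and> continuous_on (?I \<inter> U) f'" if t: "t \<in> ?I" for t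
  proof -
    obtain U g where U: "open U" "t \<in> U" "continuous_on U g"
      "\<forall>s\<in>?I \<inter> U. (f has_vector_derivative g s) (at s within ?I)" using loc[OF t] by blast
    have "continuous_on (?I \<inter> U) g" using U(3) continuous_on_subset by blast
    then have "continuous_on (?I \<inter> U) f'"
      by (rule continuous_on_eq) (use U(4) eq[symmetric] in auto)
    then show ?thesis using U by blast
  qed
  then have "continuous_on ?I f'"
    by (rule continuous_on_locally)
  then show thesis using d that by blast
qed

section \<open>Duality on the fibers\<close>

lemma densityD:
  fixes q :: "real ^ 'n::finite"
  assumes "q \<in> densities"
  shows "0 < q $ x" "q $ x \<noteq> 0" "(\<Sum>x\<in>UNIV. q $ x) = real CARD('n)"
  using assms unfolding densities_def by (auto simp: less_imp_neq[symmetric] dest: spec[of _ x])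

lemma bounded_bilinear_mean: "bounded_bilinear mean"
  unfolding bilinear_conv_bounded_bilinear[symmetric] bilinear_def mean_def
  by (auto intro!: linearI simp: sum.distrib sum_distrib_left algebra_simps add_divide_distrib)

lemmas mean_linear = bounded_bilinear.bounded_linear_right[OF bounded_bilinear_mean]
  bounded_bilinear.bounded_linear_left[OF bounded_bilinear_mean]

lemma bounded_bilinear_vec_times:
  "bounded_bilinear ((*) :: real ^ 'n::finite \<Rightarrow> real ^ 'n \<Rightarrow> real ^ 'n)"
  unfolding bilinear_conv_bounded_bilinear[symmetric] bilinear_def
  by (auto intro!: linearI simp: vec_eq_iff algebra_simps)

lemma mean_simps:
  "mean q (a + b) = mean q a + mean q b" "mean q (a - b) = mean q a - mean q b"
  "mean q (c *\<^sub>R a) = c * mean q a" "mean q 0 = 0" "mean q (- a) = - mean q a"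
  using mean_linear(1)[of q]
  by (simp_all add: linear_simps real_scaleR_def)

lemma mean_one: "q \<in> densities \<Longrightarrow> mean q 1 = 1"
  by (simp add: mean_def densityD(3))

lemma exp_transport_eq: "exp_transport p q v = v - mean q v *\<^sub>R 1"
  by (simp add: exp_transport_def vec_eq_iff)

lemma exp_transport_in_fiber: "q \<in> densities \<Longrightarrow> exp_transport p q v \<in> fiber q"
  by (simp add: exp_transport_eq fiber_def mean_simps mean_one)

lemma exp_transport_fiber: "v \<in> fiber q \<Longrightarrow> exp_transport p q v = v"
  by (simp add: exp_transport_eq fiber_def)

lemma fiber_closed:
  "0 \<in> fiber q" "a \<in> fiber q \<Longrightarrow> b \<in> fiber q \<Longrightarrow> a + b \<in> fiber q"
  "a \<in> fiber q \<Longrightarrow> b \<in> fiber q \<Longrightarrow> a - b \<in> fiber q" "a \<in> fiber q \<Longrightarrow> c *\<^sub>R a \<in> fiber q"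
  by (simp_all add: fiber_def mean_simps)

lemma pairing_unique:
  assumes q: "q \<in> densities" and g: "g \<in> fiber q" "g' \<in> fiber q"
    and eq: "\<And>\<beta>. \<beta> \<in> fiber q \<Longrightarrow> pairing q g \<beta> = pairing q g' \<beta>"
  shows "g = g'"
proof -
  let ?d = "g - g'"
  have "mean q (?d * ?d) = pairing q g ?d - pairing q g' ?d"
    by (simp add: pairing_def mean_simps(2)[symmetric] algebra_simps)
  also have "\<dots> = 0" using eq fiber_closed(3)[OF g] by simp
  finally have "(\<Sum>x\<in>UNIV. (?d $ x * ?d $ x) * q $ x) = 0" by (simp add: mean_def)
  then have "\<forall>x\<in>UNIV. (?d $ x * ?d $ x) * q $ x = 0"
    using densityD(1)[OF q]
    by (subst (asm) sum_nonneg_eq_0_iff) (auto intro!: mult_nonneg_nonneg simp: less_imp_le)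
  then show ?thesis using densityD(2)[OF q] by (simp add: vec_eq_iff)
qed

text \<open>The Riesz representative of a linear functional for the pairing at \<open>q\<close>. It lies in the
  fiber exactly when the functional kills constants.\<close>

definition fiber_repr :: "real ^ 'n::finite \<Rightarrow> (real ^ 'n \<Rightarrow> real) \<Rightarrow> real ^ 'n" where
  "fiber_repr q l = (\<chi> x. real CARD('n) / q $ x * l (axis x 1))"

lemma pairing_fiber_repr:
  assumes q: "q \<in> densities" and l: "linear l"
  shows "pairing q (fiber_repr q l) a = l a"
proof -
  have "pairing q (fiber_repr q l) a = (\<Sum>x\<in>UNIV. a $ x * l (axis x 1))"
    using densityD(2)[OF q]
    by (simp add: pairing_def mean_def fiber_repr_def sum_divide_distrib) (simp add: field_simps)
  also have "\<dots> = l (\<Sum>x\<in>UNIV. a $ x *\<^sub>R axis x 1)"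
    by (simp add: linear_sum[OF l] linear_scale[OF l])
  also have "(\<Sum>x\<in>UNIV. a $ x *\<^sub>R axis x 1) = a"
    using basis_expansion[of a] by (simp add: scalar_mult_eq_scaleR)
  finally show ?thesis .
qed

lemma fiber_repr_in_fiber:
  assumes "q \<in> densities" "linear l" "l 1 = 0"
  shows "fiber_repr q l \<in> fiber q"
  using pairing_fiber_repr[OF assms(1,2), of 1] assms(3) by (simp add: pairing_def fiber_def)

text \<open>The identification of a tangent vector of the simplex at \<open>q\<close> with an element of the fiber:
  the velocity of a curve is the score of its ordinary derivative.\<close>

definition score :: "real ^ 'n::finite \<Rightarrow> real ^ 'n \<Rightarrow> real ^ 'n" where
  "score q q' = (\<chi> x. q' $ x / q $ x)"

lemma mean_score: "q \<in> densities \<Longrightarrow> mean q (v * score q q') = mean q' v"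
  by (simp add: mean_def score_def densityD(2))

lemma score_in_fiber: "q \<in> densities \<Longrightarrow> (\<Sum>x\<in>UNIV. q' $ x) = 0 \<Longrightarrow> score q q' \<in> fiber q"
  by (simp add: fiber_def mean_def score_def densityD(2))

lemma times_score: "q \<in> densities \<Longrightarrow> q * score q q' = q'"
  by (simp add: score_def vec_eq_iff densityD(2))

section \<open>The two gradients as components of the differential\<close>

text \<open>What a local extension of the Lagrangian to the ambient space has to provide: it may be
  differentiated there, with a continuous differential, although only its values on the bundle
  belong to the Lagrangian.\<close>

definition C1_extension ::
  "'n::finite lagrangian \<Rightarrow> (((real ^ 'n) \<times> (real ^ 'n)) \<times> real) set \<Rightarrow>
   (((real ^ 'n) \<times> (real ^ 'n)) \<times> real \<Rightarrow> real) \<Rightarrow> bool" where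
  "C1_extension L U F \<longleftrightarrow> open U \<and>
     (\<forall>z\<in>U. (F has_derivative frechet_derivative F (at z)) (at z)) \<and>
     (\<forall>v. continuous_on U (\<lambda>z. frechet_derivative F (at z) v)) \<and>
     (\<forall>q w t. (q, w) \<in> stat_bundle \<and> t \<in> {0..1} \<and> ((q, w), t) \<in> U \<longrightarrow> F ((q, w), t) = L q w t)"

lemma smooth_lagrangian_extension:
  assumes "smooth_lagrangian L" "(q, w) \<in> stat_bundle" "t \<in> {0..1}"
  obtains U F where "C1_extension L U F" "((q, w), t) \<in> U"
proof -
  have z: "((q, w), t) \<in> stat_bundle \<times> {0..1}" using assms by simp
  obtain U F where
    F: "open U" "((q, w), t) \<in> U" "\<And>k. Ck_on k F U"
      "\<And>y. y \<in> (stat_bundle \<times> {0..1}) \<inter> U \<Longrightarrow> F y = (\<lambda>((q, w), t). L q w t) y"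
    using smooth_map_onE[OF assms(1)[unfolded smooth_lagrangian_def] z] by metis
  have "C1_extension L U F"
    unfolding C1_extension_def
    using F(1,4) Ck_on_Suc_derivative[OF F(3)[of "Suc 0"]] by force
  then show thesis using F(2) that by blast
qed

text \<open>The tangent space of the bundle at \<open>(q, w)\<close> splits into vertical vectors \<open>(0, \<beta>)\<close> and
  horizontal vectors \<open>(q h, - E[w h])\<close> with \<open>\<beta>\<close> and \<open>h\<close> in the fiber; the latter are the velocities
  of exponential transports of \<open>w\<close>. The two covectors are a differential \<open>D\<close> on the ambient space
  restricted to these summands. Their argument is centered to make them functionals on the whole
  function space with the constants in the kernel, as the Riesz representative requires.\<close>

definition fiber_covector :: "(((real ^ 'n) \<times> (real ^ 'n)) \<times> real \<Rightarrow> real) \<Rightarrow> real ^ 'n::finite \<Rightarrow> real ^ 'n \<Rightarrow> real" where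
  "fiber_covector D q a = D ((0, exp_transport q q a), 0)"

definition base_covector ::
  "(((real ^ 'n) \<times> (real ^ 'n)) \<times> real \<Rightarrow> real) \<Rightarrow> real ^ 'n::finite \<Rightarrow> real ^ 'n \<Rightarrow> real ^ 'n \<Rightarrow> real" where
  "base_covector D q w a =
     D ((q * exp_transport q q a, - mean q (w * exp_transport q q a) *\<^sub>R 1), 0)"

lemma exp_transport_simps:
  "exp_transport p q (a + b) = exp_transport p q a + exp_transport p q b"
  "exp_transport p q (c *\<^sub>R a) = c *\<^sub>R exp_transport p q a"
  "q \<in> densities \<Longrightarrow> exp_transport p q 1 = 0"
  by (simp_all add: exp_transport_eq mean_simps mean_one algebra_simps)

lemma linear_fiber_covector:
  assumes "linear D"
  shows "linear (fiber_covector D q)"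
proof
  show "fiber_covector D q (a + b) = fiber_covector D q a + fiber_covector D q b" for a b
    unfolding fiber_covector_def exp_transport_simps by (simp add: linear_add[OF assms, symmetric])
  show "fiber_covector D q (c *\<^sub>R a) = c *\<^sub>R fiber_covector D q a" for c a
    unfolding fiber_covector_def exp_transport_simps
    using linear_scale[OF assms, of c "((0, exp_transport q q a), 0)"] by simp
qed

lemma linear_base_covector:
  assumes "linear D"
  shows "linear (base_covector D q w)"
proof
  show "base_covector D q w (a + b) = base_covector D q w a + base_covector D q w b" for a b
    unfolding base_covector_def exp_transport_simps
    by (simp add: linear_add[OF assms, symmetric] distrib_left mean_simps scaleR_diff_left)
  show "base_covector D q w (c *\<^sub>R a) = c *\<^sub>R base_covector D q w a" for c a
    unfolding base_covector_def exp_transport_simps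
    using linear_scale[OF assms, of c "((q * exp_transport q q a, - mean q (w * exp_transport q q a) *\<^sub>R 1), 0)"]
    by (simp add: mean_simps)
qed

text \<open>A tangent vector \<open>(q', w')\<close> has horizontal component \<open>h = q' / q\<close>; subtracting its
  horizontal lift leaves the vertical part \<open>w' + E[w h]\<close>.\<close>

lemma differential_tangent:
  assumes D: "linear D" and q: "q \<in> densities"
    and q': "(\<Sum>x\<in>UNIV. q' $ x) = 0" and w': "mean q w' + mean q' w = 0"
  shows "D ((q', w'), 0) =
    base_covector D q w (score q q') + fiber_covector D q (w' + mean q (w * score q q') *\<^sub>R 1)"
proof -
  let ?h = "score q q'" and ?b = "w' + mean q (w * score q q') *\<^sub>R 1"
  have h: "exp_transport q q ?h = ?h"
    by (rule exp_transport_fiber) (rule score_in_fiber[OF q q'])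
  have b: "exp_transport q q ?b = ?b"
    by (rule exp_transport_fiber) (use w' in \<open>simp add: fiber_def mean_simps mean_one q mean_score\<close>)
  show ?thesis
    unfolding base_covector_def fiber_covector_def h b
    by (simp add: times_score[OF q] linear_add[OF D, symmetric])
qed

text \<open>The tangency conditions are the derivatives of the equations \<open>E[1] = 1\<close> and
  \<open>E[w] = 0\<close> that cut out the bundle.\<close>

lemma stat_bundle_derivative_tangent:
  fixes Q W :: "'a::real_normed_vector \<Rightarrow> real ^ 'n::finite"
  assumes Q: "(Q has_derivative Q') (at s)" and W: "(W has_derivative W') (at s)"
    and S: "open S" "s \<in> S" "\<And>s'. s' \<in> S \<Longrightarrow> (Q s', W s') \<in> stat_bundle"
  shows "(\<Sum>x\<in>UNIV. Q' k $ x) = 0" "mean (Q s) (W' k) + mean (Q' k) (W s) = 0"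
proof -
  have Qx: "((\<lambda>s. Q s $ x) has_derivative (\<lambda>k. Q' k $ x)) (at s)"
    and Wx: "((\<lambda>s. W s $ x) has_derivative (\<lambda>k. W' k $ x)) (at s)" for x
    using bounded_linear.has_derivative[OF bounded_linear_vec_nth] Q W by blast+
  have "((\<lambda>s. \<Sum>x\<in>UNIV. Q s $ x) has_derivative (\<lambda>k. \<Sum>x\<in>UNIV. Q' k $ x)) (at s)"
    by (intro has_derivative_sum Qx)
  then have "((\<lambda>s. real CARD('n)) has_derivative (\<lambda>k. \<Sum>x\<in>UNIV. Q' k $ x)) (at s)"
    by (rule has_derivative_transform_within_open[OF _ S(1,2)])
      (use S(3) in \<open>auto simp: stat_bundle_def densities_def\<close>)
  from has_derivative_unique[OF this has_derivative_const]
  show "(\<Sum>x\<in>UNIV. Q' k $ x) = 0" by metis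
  have "((\<lambda>s. \<Sum>x\<in>UNIV. W s $ x * Q s $ x) has_derivative
      (\<lambda>k. \<Sum>x\<in>UNIV. W s $ x * Q' k $ x + W' k $ x * Q s $ x)) (at s)"
    by (intro has_derivative_sum has_derivative_mult Qx Wx)
  then have "((\<lambda>s. 0) has_derivative
      (\<lambda>k. \<Sum>x\<in>UNIV. W s $ x * Q' k $ x + W' k $ x * Q s $ x)) (at s)"
    by (rule has_derivative_transform_within_open[OF _ S(1,2)])
      (use S(3) in \<open>auto simp: stat_bundle_def fiber_def mean_def\<close>)
  from has_derivative_unique[OF this has_derivative_const]
  have "(\<Sum>x\<in>UNIV. W s $ x * Q' k $ x + W' k $ x * Q s $ x) = 0" by metis
  then show "mean (Q s) (W' k) + mean (Q' k) (W s) = 0"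
    by (simp add: mean_def add_divide_distrib[symmetric] sum.distrib[symmetric] add.commute)
qed

text \<open>Only tangent directions occur here, so the differential of the extension is evaluated
  where it is determined by the Lagrangian.\<close>

lemma lagrangian_chain_rule_local:
  fixes Q W :: "'a::real_normed_vector \<Rightarrow> real ^ 'n::finite"
  assumes F: "C1_extension L U F" "((Q s, W s), t) \<in> U" and t: "t \<in> {0..1}"
    and Q: "(Q has_derivative Q') (at s)" and W: "(W has_derivative W') (at s)"
    and S: "open S" "s \<in> S" "\<And>s'. s' \<in> S \<Longrightarrow> (Q s', W s') \<in> stat_bundle"
    and D: "D = frechet_derivative F (at ((Q s, W s), t))"
  shows "((\<lambda>s. L (Q s) (W s) t) has_derivative
    (\<lambda>k. base_covector D (Q s) (W s) (score (Q s) (Q' k)) +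
         fiber_covector D (Q s) (W' k + mean (Q s) (W s * score (Q s) (Q' k)) *\<^sub>R 1))) (at s)"
proof -
  have FD: "(F has_derivative D) (at ((Q s, W s), t))" and U: "open U"
    and FL: "\<And>q w. (q, w) \<in> stat_bundle \<Longrightarrow> ((q, w), t) \<in> U \<Longrightarrow> F ((q, w), t) = L q w t"
    using F D t unfolding C1_extension_def by auto
  have q: "Q s \<in> densities" using S by (auto simp: stat_bundle_def)
  let ?Z = "\<lambda>s. ((Q s, W s), t)"
  have Z: "(?Z has_derivative (\<lambda>k. ((Q' k, W' k), 0))) (at s)"
    by (intro has_derivative_Pair Q W has_derivative_const)
  have "((\<lambda>s. F (?Z s)) has_derivative (\<lambda>k. D ((Q' k, W' k), 0))) (at s)"
    by (rule has_derivative_compose[OF Z FD])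
  moreover have "\<forall>\<^sub>F s' in at s. F (?Z s') = L (Q s') (W s') t"
  proof -
    have "(?Z \<longlongrightarrow> ?Z s) (at s)"
      using has_derivative_continuous[OF Z] by (simp add: continuous_within)
    then have "\<forall>\<^sub>F s' in at s. ?Z s' \<in> U"
      using F(2) U by (simp add: topological_tendstoD)
    moreover have "\<forall>\<^sub>F s' in at s. s' \<in> S"
      using S by (simp add: eventually_at_in_open')
    ultimately show ?thesis by eventually_elim (use FL S in auto)
  qed
  ultimately have "((\<lambda>s. L (Q s) (W s) t) has_derivative (\<lambda>k. D ((Q' k, W' k), 0))) (at s)"
    by (rule has_derivative_transform_eventually) (use FL S F in auto)
  also have "(\<lambda>k. D ((Q' k, W' k), 0)) =
    (\<lambda>k. base_covector D (Q s) (W s) (score (Q s) (Q' k)) +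
         fiber_covector D (Q s) (W' k + mean (Q s) (W s * score (Q s) (Q' k)) *\<^sub>R 1))"
    by (intro ext differential_tangent[OF has_derivative_linear[OF FD] q]
        stat_bundle_derivative_tangent[OF Q W S])
  finally show ?thesis .
qed

text \<open>The straight line \<open>w + s \<beta>\<close> is a vertical curve in the bundle, so only the vertical
  covector contributes.\<close>

lemma fiber_grad_eq:
  assumes F: "C1_extension L U F" "((q, w), t) \<in> U" and t: "t \<in> {0..1}"
    and qw: "(q, w) \<in> stat_bundle" and D: "D = frechet_derivative F (at ((q, w), t))"
  shows "fiber_grad L q w t = fiber_repr q (fiber_covector D q)"
    and "fiber_grad L q w t \<in> fiber q"
    and "pairing q (fiber_grad L q w t) a = fiber_covector D q a"
proof -
  have q: "q \<in> densities" using qw by (simp add: stat_bundle_def)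
  have linD: "linear D" using F unfolding C1_extension_def D by (auto intro: has_derivative_linear)
  note lin = linear_fiber_covector[OF linD, of q]
  let ?g = "fiber_repr q (fiber_covector D q)"
  have pg: "pairing q ?g a = fiber_covector D q a" for a
    by (rule pairing_fiber_repr[OF q lin])
  have g: "?g \<in> fiber q"
    using linear_0[OF linD] exp_transport_simps(3)[OF q]
    by (intro fiber_repr_in_fiber[OF q lin]) (simp add: fiber_covector_def zero_prod_def)
  have der: "((\<lambda>s. L q (w + s *\<^sub>R \<beta>) t) has_real_derivative pairing q ?g \<beta>) (at 0)"
    if \<beta>: "\<beta> \<in> fiber q" for \<beta>
  proof -
    have "((\<lambda>s. L q (w + s *\<^sub>R \<beta>) t) has_derivative
      (\<lambda>k. base_covector D q (w + 0 *\<^sub>R \<beta>) (score q 0) +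
         fiber_covector D q (k *\<^sub>R \<beta> + mean q ((w + 0 *\<^sub>R \<beta>) * score q 0) *\<^sub>R 1))) (at 0)"
    proof (rule lagrangian_chain_rule_local[where S = UNIV and Q = "\<lambda>s. q" and F = F and U = U])
      show "((\<lambda>s. w + s *\<^sub>R \<beta>) has_derivative (\<lambda>k. k *\<^sub>R \<beta>)) (at 0)"
        by (auto intro!: derivative_eq_intros)
      show "(q, w + s *\<^sub>R \<beta>) \<in> stat_bundle" for s
        using qw \<beta> by (auto simp: stat_bundle_def fiber_closed)
    qed (use F t D in auto)
    moreover have "score q 0 = 0" by (simp add: score_def vec_eq_iff)
    ultimately have "((\<lambda>s. L q (w + s *\<^sub>R \<beta>) t) has_derivative (\<lambda>k. k * fiber_covector D q \<beta>)) (at 0)"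
      using linear_0[OF linear_base_covector[OF linD]] linear_scale[OF lin]
      by (simp add: mean_simps)
    then show ?thesis
      by (simp add: has_field_derivative_def pg mult_commute_abs)
  qed
  have "fiber_grad L q w t = ?g"
    unfolding fiber_grad_def
  proof (rule the_equality)
    fix g' assume g': "g' \<in> fiber q \<and> (\<forall>\<beta>\<in>fiber q.
      ((\<lambda>s. L q (w + s *\<^sub>R \<beta>) t) has_real_derivative pairing q g' \<beta>) (at 0))"
    show "g' = ?g"
      by (rule pairing_unique[OF q]) (use g g' der DERIV_unique in blast)+
  qed (use g der in blast)
  with g pg show "fiber_grad L q w t = ?g" "fiber_grad L q w t \<in> fiber q"
    "pairing q (fiber_grad L q w t) a = fiber_covector D q a" by simp_all
qed

lemma exp_chart_inv_density:
  assumes p: "p \<in> densities"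
  shows "exp_chart_inv p u \<in> densities" and "0 < mean p (\<chi> x. exp (u $ x))"
proof -
  let ?Z = "mean p (\<chi> x. exp (u $ x))"
  show Z: "0 < ?Z"
    by (auto simp: mean_def intro!: divide_pos_pos sum_pos mult_pos_pos densityD(1)[OF p])
  have "exp_chart_inv p u $ x = exp (u $ x) * p $ x / ?Z" for x
    using Z by (simp add: exp_chart_inv_def cumulant_def exp_diff)
  moreover have "(\<Sum>x\<in>UNIV. exp (u $ x) * p $ x / ?Z) = real CARD('a)"
    using Z by (simp add: sum_divide_distrib[symmetric] divide_eq_eq) (simp add: mean_def)
  ultimately show "exp_chart_inv p u \<in> densities"
    using Z densityD(1)[OF p] by (simp add: densities_def)
qed

text \<open>The differential of the cumulant at \<open>u\<close> is the expectation at the density \<open>q\<close> with chart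
  value \<open>u\<close>; therefore the score of \<open>e\<^sub>p\<close> in the direction \<open>k\<close> is \<open>k - E\<^sub>q[k]\<close>.\<close>

lemma exp_chart_inv_has_derivative:
  fixes p :: "real ^ 'n::finite"
  assumes p: "p \<in> densities" and q: "q = exp_chart_inv p u"
  shows "(exp_chart_inv p has_derivative (\<lambda>k. q * exp_transport q q k)) (at u)"
proof -
  let ?Z = "\<lambda>u. mean p (\<chi> x. exp (u $ x))"
  have nth: "((\<lambda>u::real^'n. u $ x) has_derivative (\<lambda>k. k $ x)) (at u)" for x
    by (rule bounded_linear_imp_has_derivative[OF bounded_linear_vec_nth])
  have Z: "(?Z has_derivative (\<lambda>k. (\<Sum>x\<in>UNIV. exp (u $ x) * k $ x * p $ x) / real CARD('n))) (at u)"
    unfolding mean_def vec_lambda_beta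
    by (rule derivative_eq_intros nth refl | simp add: mult.commute)+
  have qx: "q $ x = exp (u $ x) * p $ x / ?Z u" for x
    using exp_chart_inv_density(2)[OF p, of u] by (simp add: q exp_chart_inv_def cumulant_def exp_diff)
  have mean: "mean q k = (\<Sum>x\<in>UNIV. exp (u $ x) * k $ x * p $ x) / real CARD('n) / ?Z u" for k
    by (simp add: mean_def[of q] qx sum_divide_distrib) (simp add: mult_ac)
  have K: "(cumulant p has_derivative mean q) (at u)"
  proof -
    have "((\<lambda>u. ln (?Z u)) has_derivative (\<lambda>k. ((\<Sum>x\<in>UNIV. exp (u $ x) * k $ x * p $ x) / real CARD('n)) * inverse (?Z u))) (at u)"
      by (rule has_derivative_ln[OF exp_chart_inv_density(2)[OF p] Z])
    then show ?thesis
      unfolding cumulant_def[abs_def] mean[abs_def] by (simp add: field_simps)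
  qed
  have "((\<lambda>u. exp_chart_inv p u $ x) has_derivative (\<lambda>k. (q * exp_transport q q k) $ x)) (at u)" for x
    unfolding exp_chart_inv_def vec_lambda_beta
    by (rule derivative_eq_intros nth K refl)+
      (simp add: q exp_chart_inv_def exp_transport_def algebra_simps)
  then show ?thesis by (simp add: has_derivative_componentwise_within[of "exp_chart_inv p"] Basis_vec_def inner_axis)
qed

lemma exp_chart_inv_0: "q \<in> densities \<Longrightarrow> exp_chart_inv q 0 = q"
  using mean_one[of q]
  by (simp add: exp_chart_inv_def cumulant_def vec_eq_iff one_vec_def zero_vec_def)

text \<open>In any exponential chart, varying \<open>u\<close> with \<open>v\<close> fixed moves \<open>(q, w)\<close> along horizontal
  vectors, whatever the centre \<open>p\<close>. Hence the horizontal covector represents the differential in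
  every chart, and the chart centred at \<open>q\<close> itself already determines the gradient.\<close>

lemma nat_grad_eq:
  fixes L :: "'n::finite lagrangian"
  assumes F: "C1_extension L U F" "((q, w), t) \<in> U" and t: "t \<in> {0..1}"
    and qw: "(q, w) \<in> stat_bundle" and D: "D = frechet_derivative F (at ((q, w), t))"
  shows "nat_grad L q w t = fiber_repr q (base_covector D q w)"
    and "nat_grad L q w t \<in> fiber q"
    and "pairing q (nat_grad L q w t) a = base_covector D q w a"
proof -
  have q: "q \<in> densities" and w: "w \<in> fiber q" using qw by (simp_all add: stat_bundle_def)
  have linD: "linear D" using F unfolding C1_extension_def D by (auto intro: has_derivative_linear)
  note lin = linear_base_covector[OF linD, of q w]
  let ?l = "base_covector D q w"
  let ?g = "fiber_repr q ?l"
  have pg: "pairing q ?g a = ?l a" for a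
    by (rule pairing_fiber_repr[OF q lin])
  have g: "?g \<in> fiber q"
    using linear_0[OF linD] exp_transport_simps(3)[OF q]
    by (intro fiber_repr_in_fiber[OF q lin]) (simp add: base_covector_def zero_prod_def mean_simps)
  have der: "((\<lambda>u. chart_lagrangian L p u v t) has_derivative ?l) (at u)"
    if p: "p \<in> densities" and u: "exp_chart_inv p u = q" and v: "exp_transport p q v = w" for p u v
  proof -
    let ?Q = "exp_chart_inv p" and ?W = "\<lambda>u. exp_transport p (exp_chart_inv p u) v"
    let ?Q' = "\<lambda>k. q * exp_transport q q k"
    let ?W' = "\<lambda>k. - mean (?Q' k) v *\<^sub>R (1 :: real ^ 'n)"
    have dQ: "(?Q has_derivative ?Q') (at u)"
      by (rule exp_chart_inv_has_derivative[OF p u[symmetric]])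
    have dW: "(?W has_derivative ?W') (at u)"
    proof -
      have "((\<lambda>u. mean (?Q u) v) has_derivative (\<lambda>k. mean (?Q' k) v)) (at u)"
        by (rule bounded_linear.has_derivative[OF mean_linear(2) dQ])
      then show ?thesis unfolding exp_transport_eq
        by (auto intro!: derivative_eq_intros)
    qed
    have "((\<lambda>u. L (?Q u) (?W u) t) has_derivative
      (\<lambda>k. base_covector D (?Q u) (?W u) (score (?Q u) (?Q' k)) +
         fiber_covector D (?Q u) (?W' k + mean (?Q u) (?W u * score (?Q u) (?Q' k)) *\<^sub>R 1))) (at u)"
      by (rule lagrangian_chain_rule_local[where S = UNIV and F = F and U = U])
        (use F t u v D dQ dW exp_chart_inv_density[OF p] in
          \<open>auto simp: stat_bundle_def exp_transport_eq fiber_def mean_simps mean_one\<close>)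
    moreover have "base_covector D q w (score q (?Q' k)) +
         fiber_covector D q (?W' k + mean q (w * score q (?Q' k)) *\<^sub>R 1) = ?l k" for k
    proof -
      have s: "score q (?Q' k) = exp_transport q q k"
        using densityD(2)[OF q] by (simp add: score_def vec_eq_iff)
      have "mean (?Q' k) 1 = mean q (exp_transport q q k)"
        by (simp add: mean_def mult.commute)
      then have "mean (?Q' k) 1 = 0"
        using exp_transport_in_fiber[OF q] by (simp add: fiber_def)
      have "mean q (w * score q (?Q' k)) = mean (?Q' k) w" by (rule mean_score[OF q])
      also have "\<dots> = mean (?Q' k) v"
        using \<open>mean (?Q' k) 1 = 0\<close> by (simp add: v[symmetric] exp_transport_eq mean_simps)
      \<comment> \<open>The motion is horizontal.\<close>
      finally have "?W' k + mean q (w * score q (?Q' k)) *\<^sub>R 1 = 0"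
        by simp
      then show ?thesis
        using linear_0[OF linear_fiber_covector[OF linD]] exp_transport_fiber[OF exp_transport_in_fiber[OF q]]
        by (simp add: s base_covector_def)
    qed
    ultimately show ?thesis using u v by (simp add: chart_lagrangian_def)
  qed
  have l_transport: "?l (exp_transport q p h) = ?l h" for p h
  proof -
    have "exp_transport q q (exp_transport q p h) = exp_transport q q h"
      using mean_one[OF q] by (simp add: exp_transport_eq mean_simps scaleR_diff_left)
    then show ?thesis by (simp add: base_covector_def)
  qed
  have "nat_grad L q w t = ?g"
    unfolding nat_grad_def
  proof (rule the_equality)
    have "\<exists>D'. ((\<lambda>u. chart_lagrangian L p u v t) has_derivative D') (at u within fiber p) \<and>
        (\<forall>h\<in>fiber q. pairing q ?g h = D' (exp_transport q p h))"
      if "p \<in> densities" "exp_chart_inv p u = q" "exp_transport p q v = w" for p u v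
      using has_derivative_at_withinI[OF der[OF that]] pg l_transport by (intro exI[of _ ?l]) auto
    then show "?g \<in> fiber q \<and> (\<forall>p\<in>densities. \<forall>u\<in>fiber p. \<forall>v\<in>fiber p.
           exp_chart_inv p u = q \<and> exp_transport p q v = w \<longrightarrow>
           (\<exists>D. ((\<lambda>u'. chart_lagrangian L p u' v t) has_derivative D) (at u within fiber p) \<and>
                (\<forall>h\<in>fiber q. pairing q ?g h = D (exp_transport q p h))))"
      using g by blast
  next
    fix g' assume g': "g' \<in> fiber q \<and> (\<forall>p\<in>densities. \<forall>u\<in>fiber p. \<forall>v\<in>fiber p.
           exp_chart_inv p u = q \<and> exp_transport p q v = w \<longrightarrow>
           (\<exists>D. ((\<lambda>u'. chart_lagrangian L p u' v t) has_derivative D) (at u within fiber p) \<and>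
                (\<forall>h\<in>fiber q. pairing q g' h = D (exp_transport q p h))))"
    have ww: "exp_transport q q w = w" by (rule exp_transport_fiber[OF w])
    obtain D' where D': "((\<lambda>u'. chart_lagrangian L q u' w t) has_derivative D') (at 0 within fiber q)"
      "\<forall>h\<in>fiber q. pairing q g' h = D' (exp_transport q q h)"
      using g' q w ww exp_chart_inv_0[OF q] fiber_closed(1)[of q] by blast
    show "g' = ?g"
    proof (rule pairing_unique[OF q])
      fix h assume h: "h \<in> fiber q"
      \<comment> \<open>Differentials within the fiber are compared along lines, where derivatives are unique.\<close>
      have line: "((\<lambda>s. s *\<^sub>R h) has_derivative (\<lambda>s. s *\<^sub>R h)) (at 0)"
        by (auto intro!: derivative_eq_intros)
      have "((\<lambda>u'. chart_lagrangian L q u' w t) has_derivative D')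
          (at (0 *\<^sub>R h) within (\<lambda>s. s *\<^sub>R h) ` UNIV)"
        using D'(1) h by (auto intro: has_derivative_subset fiber_closed)
      from has_derivative_in_compose[OF line this]
      have "((\<lambda>s. chart_lagrangian L q (s *\<^sub>R h) w t) has_derivative (\<lambda>s. D' (s *\<^sub>R h))) (at 0)" .
      moreover have "((\<lambda>s. chart_lagrangian L q (s *\<^sub>R h) w t) has_derivative (\<lambda>s. ?l (s *\<^sub>R h))) (at 0)"
        using has_derivative_compose[OF line, of "\<lambda>u. chart_lagrangian L q u w t" ?l]
          der[OF q exp_chart_inv_0[OF q] ww] by simp
      ultimately have "D' (1 *\<^sub>R h) = ?l (1 *\<^sub>R h)" by (metis has_derivative_unique)
      then show "pairing q g' h = pairing q ?g h"
        using D'(2) h pg exp_transport_fiber[OF h] by simp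
    qed (use g g' in auto)
  qed
  with g pg show "nat_grad L q w t = ?g" "nat_grad L q w t \<in> fiber q"
    "pairing q (nat_grad L q w t) a = ?l a" by simp_all
qed

text \<open>The description of the differential that is used from here on; the extensions have
  disappeared from it.\<close>

lemma lagrangian_chain_rule:
  fixes Q W :: "'a::real_normed_vector \<Rightarrow> real ^ 'n::finite"
  assumes L: "smooth_lagrangian L" and t: "t \<in> {0..1}"
    and Q: "(Q has_derivative Q') (at s)" and W: "(W has_derivative W') (at s)"
    and S: "open S" "s \<in> S" "\<And>s'. s' \<in> S \<Longrightarrow> (Q s', W s') \<in> stat_bundle"
  shows "((\<lambda>s. L (Q s) (W s) t) has_derivative
    (\<lambda>k. pairing (Q s) (nat_grad L (Q s) (W s) t) (score (Q s) (Q' k)) +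
         pairing (Q s) (fiber_grad L (Q s) (W s) t) (W' k + mean (Q s) (W s * score (Q s) (Q' k)) *\<^sub>R 1))) (at s)"
proof -
  obtain U F where F: "C1_extension L U F" "((Q s, W s), t) \<in> U"
    using smooth_lagrangian_extension[OF L S(3)[OF S(2)] t] by metis
  show ?thesis
    using lagrangian_chain_rule_local[OF F t Q W S refl]
    unfolding nat_grad_eq(3)[OF F t S(3)[OF S(2)] refl] fiber_grad_eq(3)[OF F t S(3)[OF S(2)] refl] .
qed

lemma gradients_in_fiber:
  assumes L: "smooth_lagrangian L" and qw: "(q, w) \<in> stat_bundle" and t: "t \<in> {0..1}"
  shows "fiber_grad L q w t \<in> fiber q" "nat_grad L q w t \<in> fiber q"
proof -
  obtain U F where F: "C1_extension L U F" "((q, w), t) \<in> U"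
    using smooth_lagrangian_extension[OF L qw t] by metis
  show "fiber_grad L q w t \<in> fiber q" by (rule fiber_grad_eq(2)[OF F t qw refl])
  show "nat_grad L q w t \<in> fiber q" by (rule nat_grad_eq(2)[OF F t qw refl])
qed

text \<open>In finite dimension, pointwise continuity of a family of linear maps is joint
  continuity.\<close>

lemma continuous_on_apply_linear:
  fixes v :: "'a::topological_space \<Rightarrow> 'b::euclidean_space"
  assumes D: "\<And>v. continuous_on S (\<lambda>z. D z v)" "\<And>z. z \<in> S \<Longrightarrow> linear (D z)"
    and v: "continuous_on S v"
  shows "continuous_on S (\<lambda>z. D z (v z) :: real)"
proof -
  have "continuous_on S (\<lambda>z. \<Sum>b\<in>Basis. (v z \<bullet> b) * D z b)"
    by (intro continuous_intros D v)
  moreover have "(\<Sum>b\<in>Basis. (v z \<bullet> b) * D z b) = D z (v z)" if z: "z \<in> S" for z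
  proof -
    have "D z (v z) = D z (\<Sum>b\<in>Basis. (v z \<bullet> b) *\<^sub>R b)" by (simp add: euclidean_representation)
    then show ?thesis by (simp add: linear_sum[OF D(2)[OF z]] linear_scale[OF D(2)[OF z]])
  qed
  ultimately show ?thesis by (rule continuous_on_eq)
qed

lemmas continuous_on_mean [continuous_intros] =
  bounded_bilinear.continuous_on[OF bounded_bilinear_mean]

lemmas continuous_on_vec_times [continuous_intros] =
  bounded_bilinear.continuous_on[OF bounded_bilinear_vec_times]

lemma continuous_on_gradients:
  fixes L :: "'n::finite lagrangian"
  assumes L: "smooth_lagrangian L"
  shows "continuous_on (stat_bundle \<times> {0..1}) (\<lambda>((q, w), t). fiber_grad L q w t)" (is ?A)
    and "continuous_on (stat_bundle \<times> {0..1}) (\<lambda>((q, w), t). nat_grad L q w t)" (is ?B)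
proof -
  let ?S = "stat_bundle \<times> {0..1} :: (((real ^ 'n) \<times> (real ^ 'n)) \<times> real) set"
  have loc: "\<exists>U. open U \<and> z \<in> U \<and>
      continuous_on (?S \<inter> U) (\<lambda>((q, w), t). fiber_grad L q w t) \<and>
      continuous_on (?S \<inter> U) (\<lambda>((q, w), t). nat_grad L q w t)" if z: "z \<in> ?S" for z
  proof -
    obtain q w t where zq: "z = ((q, w), t)" by (metis surj_pair)
    obtain U F where F: "C1_extension L U F" and zU: "z \<in> U"
      using smooth_lagrangian_extension[OF L, of q w t] z zq by auto
    let ?T = "?S \<inter> U" and ?D = "\<lambda>z. frechet_derivative F (at z)"
    have lin: "linear (?D z)" if "z \<in> ?T" for z
      using F that unfolding C1_extension_def by (auto intro: has_derivative_linear)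
    have contD: "continuous_on ?T (\<lambda>z. ?D z v)" for v
      using F continuous_on_subset[OF _ Int_lower2] unfolding C1_extension_def by blast
    have "fst (fst z) $ x \<noteq> 0" if "z \<in> ?T" for z x
      using that by (auto simp: stat_bundle_def densityD(2))
    note [continuous_intros] = continuous_on_apply_linear[OF contD lin] and nz = this
    have "continuous_on ?T (\<lambda>z. fiber_repr (fst (fst z)) (fiber_covector (?D z) (fst (fst z))))"
      unfolding fiber_repr_def fiber_covector_def exp_transport_eq
      by (intro continuous_intros lin contD) (use nz in auto)
    then have A: "continuous_on ?T (\<lambda>((q, w), t). fiber_grad L q w t)"
      by (rule continuous_on_eq) (use fiber_grad_eq(1)[OF F _ _ _ refl] in auto)
    have "continuous_on ?T (\<lambda>z. fiber_repr (fst (fst z)) (base_covector (?D z) (fst (fst z)) (snd (fst z))))"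
      unfolding fiber_repr_def base_covector_def exp_transport_eq
      by (intro continuous_intros lin contD) (use nz in auto)
    then have "continuous_on ?T (\<lambda>((q, w), t). nat_grad L q w t)"
      by (rule continuous_on_eq) (use nat_grad_eq(1)[OF F _ _ _ refl] in auto)
    with A show ?thesis using zU F unfolding C1_extension_def by blast
  qed
  show ?A by (rule continuous_on_locally) (use loc in blast)
  show ?B by (rule continuous_on_locally) (use loc in blast)
qed

section \<open>The du Bois-Reymond lemma\<close>

lemma polynomial_antiderivative:
  assumes "real_polynomial_function (\<rho> :: real \<Rightarrow> real)"
  obtains \<phi> where "real_polynomial_function \<phi>" "\<phi> 0 = 0"
    "\<And>t. (\<phi> has_real_derivative \<rho> t) (at t)"
proof -
  obtain a n where \<rho>: "\<rho> = (\<lambda>x. \<Sum>i\<le>n. a i * x ^ i)"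
    using assms real_polynomial_function_iff_sum by blast
  let ?\<phi> = "\<lambda>x. \<Sum>i\<le>n. a i / (real i + 1) * x ^ Suc i"
  have "real_polynomial_function ?\<phi>"
    by (intro real_polynomial_function_sum real_polynomial_function.intros
        real_polynomial_function_power bounded_linear_ident) auto
  moreover have "(?\<phi> has_real_derivative \<rho> t) (at t)" for t
  proof -
    have "((\<lambda>x. a i / (real i + 1) * x ^ Suc i) has_real_derivative a i * t ^ i) (at t)" for i
      using DERIV_cmult[OF DERIV_pow[of "Suc i" t], of "a i / (real i + 1)"]
      by (simp add: add.commute nonzero_divide_eq_eq del: power_Suc)
    then show ?thesis unfolding \<rho> by (intro DERIV_sum)
  qed
  ultimately show thesis by (intro that[of ?\<phi>]) auto
qed

text \<open>Integrating \<open>\<phi> G\<close> by parts with \<open>\<Gamma>\<close> an antiderivative of \<open>G\<close> shows that \<open>P - \<Gamma>\<close> is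
  orthogonal to the derivatives of all test functions, which are the polynomials of mean zero. After
  subtraction of its mean it is orthogonal to all polynomials, hence zero by the Weierstrass theorem.
  Polynomial test functions are smooth up to the end points and need no bump functions, and the
  differentiability of \<open>P\<close> is part of the conclusion.\<close>

lemma weak_derivative_imp_derivative:
  fixes P G :: "real \<Rightarrow> real"
  assumes P: "continuous_on {0..1} P" and G: "continuous_on {0..1} G"
    and weak: "\<And>\<phi> \<phi>'. real_polynomial_function \<phi> \<Longrightarrow> real_polynomial_function \<phi>' \<Longrightarrow>
      (\<And>t. (\<phi> has_real_derivative \<phi>' t) (at t)) \<Longrightarrow> \<phi> 0 = 0 \<Longrightarrow> \<phi> 1 = 0 \<Longrightarrow>
      integral {0..1} (\<lambda>t. \<phi> t * G t + \<phi>' t * P t) = 0"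
    and t: "t \<in> {0..1}"
  shows "(P has_real_derivative G t) (at t within {0..1})"
proof -
  let ?I = "{0..1::real}"
  define \<Gamma> where "\<Gamma> = (\<lambda>t. integral {0..t} G)"
  have d\<Gamma>: "(\<Gamma> has_real_derivative G t) (at t within ?I)" if "t \<in> ?I" for t
    unfolding \<Gamma>_def by (rule integral_has_real_derivative[OF G that])
  have c\<Gamma>: "continuous_on ?I \<Gamma>" using d\<Gamma> by (meson DERIV_continuous_on)
  define c where "c = integral ?I (\<lambda>t. P t - \<Gamma> t)"
  define f where "f = (\<lambda>t. P t - \<Gamma> t - c)"
  have cf: "continuous_on ?I f" unfolding f_def by (intro continuous_on_diff continuous_on_const P c\<Gamma>)
  have orth: "integral ?I (\<lambda>t. r t * f t) = 0" if r: "real_polynomial_function r" for r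
  proof -
    define m where "m = integral ?I r"
    have cr: "continuous_on ?I r" by (rule smooth_map_on_continuous_on[OF smooth_map_on_polynomial[OF r]])
    \<comment> \<open>Subtracting the mean makes the antiderivative vanish at both end points.\<close>
    have r': "real_polynomial_function (\<lambda>t. r t - m)"
      by (intro real_polynomial_function_diff r real_polynomial_function.intros(2))
    obtain \<phi> where \<phi>: "real_polynomial_function \<phi>" "\<phi> 0 = 0"
      "\<And>t. (\<phi> has_real_derivative r t - m) (at t)"
      using polynomial_antiderivative[OF r'] by blast
    have c\<phi>: "continuous_on ?I \<phi>" by (rule smooth_map_on_continuous_on[OF smooth_map_on_polynomial[OF \<phi>(1)]])
    have "((\<lambda>t. r t - m) has_integral \<phi> 1 - \<phi> 0) ?I"
      using \<phi>(3) by (intro fundamental_theorem_of_calculus)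
        (auto simp: has_real_derivative_iff_has_vector_derivative intro: has_vector_derivative_at_within)
    moreover have "integral ?I (\<lambda>t. r t - m) = 0"
      using cr by (simp add: integral_diff integrable_continuous_real m_def)
    ultimately have \<phi>1: "\<phi> 1 = 0" using \<phi>(2) by (metis diff_zero integral_unique)
    have "((\<lambda>t. \<phi> t * G t + (r t - m) * \<Gamma> t) has_integral \<phi> 1 * \<Gamma> 1 - \<phi> 0 * \<Gamma> 0) ?I"
    proof (rule fundamental_theorem_of_calculus)
      fix t assume t: "t \<in> ?I"
      show "((\<lambda>t. \<phi> t * \<Gamma> t) has_vector_derivative \<phi> t * G t + (r t - m) * \<Gamma> t) (at t within ?I)"
        unfolding has_real_derivative_iff_has_vector_derivative[symmetric]
        using DERIV_mult'[OF has_field_derivative_at_within[OF \<phi>(3)] d\<Gamma>[OF t]] by simp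
    qed simp
    then have "integral ?I (\<lambda>t. \<phi> t * G t + (r t - m) * \<Gamma> t) = 0"
      using \<phi>(2) \<phi>1 by (simp add: integral_unique)
    moreover have "integral ?I (\<lambda>t. \<phi> t * G t + (r t - m) * P t) = 0"
      by (rule weak[OF \<phi>(1) r' \<phi>(3,2) \<phi>1])
    ultimately have "integral ?I (\<lambda>t. (\<phi> t * G t + (r t - m) * P t) - (\<phi> t * G t + (r t - m) * \<Gamma> t)) = 0"
      by (subst integral_diff) (auto intro!: integrable_continuous_real continuous_intros c\<phi> G P c\<Gamma> cr)
    then have 1: "integral ?I (\<lambda>t. (r t - m) * (P t - \<Gamma> t)) = 0"
      by (simp add: algebra_simps)
    have "integral ?I (\<lambda>t. r t * f t) =
      integral ?I (\<lambda>t. (r t - m) * (P t - \<Gamma> t) + m * (P t - \<Gamma> t) - c * r t)"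
      by (simp add: f_def algebra_simps)
    also have "\<dots> = m * c - c * m"
      using 1 by (subst integral_diff integral_add;
          auto intro!: integrable_continuous_real continuous_intros P c\<Gamma> cr simp: c_def m_def)+
    finally show ?thesis by simp
  qed
  have zero: "integral ?I (\<lambda>t. f t * f t) = 0"
  proof (rule ccontr)
    assume ne: "integral ?I (\<lambda>t. f t * f t) \<noteq> 0"
    let ?A = "integral ?I (\<lambda>t. f t * f t)"
    have "bounded (f ` ?I)" by (intro compact_imp_bounded compact_continuous_image cf compact_Icc)
    then obtain M where M: "M > 0" "\<And>t. t \<in> ?I \<Longrightarrow> \<bar>f t\<bar> \<le> M"
      unfolding bounded_pos by fastforce
    have e: "\<bar>?A\<bar> / (2 * M) > 0" using ne M by simp
    obtain r where r: "real_polynomial_function r" "\<And>t. t \<in> ?I \<Longrightarrow> \<bar>f t - r t\<bar> < \<bar>?A\<bar> / (2 * M)"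
      using Stone_Weierstrass_real_polynomial_function[OF compact_Icc cf e] by blast
    have cr: "continuous_on ?I r" by (rule smooth_map_on_continuous_on[OF smooth_map_on_polynomial[OF r(1)]])
    have A: "?A = integral ?I (\<lambda>t. (f t - r t) * f t)"
      using orth[OF r(1)]
      by (simp add: left_diff_distrib integral_diff integrable_continuous_real continuous_on_mult cf cr)
    have "norm (integral ?I (\<lambda>t. (f t - r t) * f t)) \<le> (\<bar>?A\<bar> / (2 * M) * M) * (1 - 0)"
    proof (rule integral_bound)
      show "norm ((f t - r t) * f t) \<le> \<bar>?A\<bar> / (2 * M) * M" if "t \<in> ?I" for t
        unfolding real_norm_def abs_mult
        by (rule mult_mono) (use r(2)[OF that] M(2)[OF that] e in auto)
    qed (auto intro!: continuous_intros cf cr)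
    then show False using A ne M by simp
  qed
  have "f t = 0" if "t \<in> ?I" for t
  proof -
    have "(\<lambda>t. f t * f t) integrable_on ?I" by (intro integrable_continuous_real continuous_intros cf)
    then have "((\<lambda>t. f t * f t) has_integral 0) (cbox 0 1)" using zero by (simp add: has_integral_integral)
    then show ?thesis
      using has_integral_0_cbox_imp_0[of 0 1 "\<lambda>t. f t * f t" t] cf that by (auto intro: continuous_intros)
  qed
  then have "P s = \<Gamma> s + c" if "s \<in> ?I" for s using that by (force simp: f_def)
  moreover have "((\<lambda>s. \<Gamma> s + c) has_real_derivative G t) (at t within ?I)"
    using d\<Gamma>[OF t] by (auto intro!: derivative_eq_intros)
  ultimately show ?thesis
    using t by (auto intro: has_field_derivative_transform_within[where d = 1])
qed

section \<open>First variation of the action\<close>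

lemma has_vector_derivative_vec:
  fixes f :: "real \<Rightarrow> real ^ 'n::finite"
  shows "(f has_vector_derivative f') (at t within S) \<longleftrightarrow>
    (\<forall>x. ((\<lambda>s. f s $ x) has_vector_derivative f' $ x) (at t within S))"
  unfolding has_vector_derivative_def
  by (subst has_derivative_componentwise_within) (simp add: Basis_vec_def inner_axis)

lemma velocity_eq:
  fixes q :: "real \<Rightarrow> real ^ 'n::finite"
  assumes q: "(q has_vector_derivative q') (at t within {0..1})" and t: "t \<in> {0..1}"
    and pos: "q t \<in> densities"
  shows "velocity q t = score (q t) q'"
proof -
  have "((\<lambda>s. ln (q s $ x)) has_real_derivative q' $ x / q t $ x) (at t within {0..1})" for x
  proof -
    have "((\<lambda>s. q s $ x) has_real_derivative q' $ x) (at t within {0..1})"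
      using q by (simp add: has_vector_derivative_vec has_real_derivative_iff_has_vector_derivative)
    then show ?thesis
      using densityD(1)[OF pos, of x] by (auto intro!: derivative_eq_intros)
  qed
  then have "((\<lambda>s. \<chi> x. ln (q s $ x)) has_vector_derivative score (q t) q') (at t within {0..1})"
    by (simp add: has_vector_derivative_vec has_real_derivative_iff_has_vector_derivative score_def)
  then show ?thesis
    unfolding velocity_def using t
    by (auto intro: vector_derivative_within_cbox[of 0 1, simplified])
qed

lemma sum_derivative_zero:
  fixes f :: "real \<Rightarrow> real ^ 'n::finite"
  assumes f: "(f has_vector_derivative f') (at t within {0..1})" and t: "t \<in> {0..1}"
    and const: "\<And>t. t \<in> {0..1} \<Longrightarrow> (\<Sum>x\<in>UNIV. f t $ x) = c"
  shows "(\<Sum>x\<in>UNIV. f' $ x) = 0"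
proof -
  have "((\<lambda>s. \<Sum>x\<in>UNIV. f s $ x) has_vector_derivative (\<Sum>x\<in>UNIV. f' $ x)) (at t within {0..1})"
    using f by (intro has_vector_derivative_sum) (simp add: has_vector_derivative_vec)
  then have "((\<lambda>s. c) has_vector_derivative (\<Sum>x\<in>UNIV. f' $ x)) (at t within {0..1})"
    by (rule has_vector_derivative_transform[OF t, rotated]) (use const in auto)
  moreover have "((\<lambda>s. c) has_vector_derivative 0) (at t within {0..1})" by simp
  ultimately show ?thesis
    using vector_derivative_within_cbox[of 0 1 t] t
    by (metis box_real(2) zero_less_one)
qed

lemma velocity_in_bundle:
  fixes q :: "real \<Rightarrow> real ^ 'n::finite"
  assumes q: "(q has_vector_derivative q') (at t within {0..1})" and t: "t \<in> {0..1}"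
    and qd: "\<And>t. t \<in> {0..1} \<Longrightarrow> q t \<in> densities"
  shows "(q t, velocity q t) \<in> stat_bundle"
proof -
  have "(\<Sum>x\<in>UNIV. q' $ x) = 0"
    by (rule sum_derivative_zero[OF q t]) (rule densityD(3)[OF qd])
  then show ?thesis
    by (simp add: stat_bundle_def velocity_eq[OF q t qd[OF t]] qd[OF t] score_in_fiber)
qed

lemma continuous_on_score [continuous_intros]:
  assumes "continuous_on S f" "continuous_on S g" "\<And>z. z \<in> S \<Longrightarrow> f z \<in> densities"
  shows "continuous_on S (\<lambda>z. score (f z) (g z))"
  unfolding score_def by (intro continuous_intros assms) (use assms(3) densityD(2) in blast)

lemma continuous_on_pairing [continuous_intros]:
  assumes "continuous_on S f" "continuous_on S g" "continuous_on S h"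
  shows "continuous_on S (\<lambda>z. pairing (f z) (g z) (h z))"
  unfolding pairing_def by (intro continuous_intros assms)

lemma pairing_scaleR: "pairing q g (c *\<^sub>R a) = c * pairing q g a"
  by (simp add: pairing_def mean_def sum_distrib_left mult_ac)

lemma score_scaleR: "score q (c *\<^sub>R a) = c *\<^sub>R score q a"
  by (simp add: score_def vec_eq_iff)

lemma differentiate_integral:
  fixes f f' :: "real \<Rightarrow> real \<Rightarrow> real"
  assumes der: "\<And>s t. s \<in> {-\<epsilon><..<\<epsilon>} \<Longrightarrow> t \<in> {0..1} \<Longrightarrow>
      ((\<lambda>s. f s t) has_real_derivative f' s t) (at s)"
    and int: "\<And>s. s \<in> {-\<epsilon><..<\<epsilon>} \<Longrightarrow> f s integrable_on {0..1}"
    and cont: "continuous_on ({-\<epsilon><..<\<epsilon>} \<times> {0..1}) (\<lambda>(s, t). f' s t)" and \<epsilon>: "\<epsilon> > 0"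
  shows "((\<lambda>s. integral {0..1} (f s)) has_real_derivative integral {0..1} (f' 0)) (at 0)"
proof -
  have "((\<lambda>s. integral (cbox 0 1) (f s)) has_real_derivative integral (cbox 0 1) (f' 0))
      (at 0 within {-\<epsilon><..<\<epsilon>})"
    by (rule leibniz_rule_field_derivative)
      (use der int cont \<epsilon> in \<open>auto intro: has_field_derivative_at_within\<close>)
  then show ?thesis using \<epsilon> by (simp add: at_within_open[of 0 "{-\<epsilon><..<\<epsilon>}"])
qed

text \<open>The variation \<open>q + s k\<close> is affine in \<open>s\<close>, so it stays in the simplex of densities for small
  \<open>s\<close> and its smoothness is that of \<open>q\<close> and \<open>k\<close>. Its horizontal component is \<open>h = k / q\<close>, and the
  velocity changes at the rate \<open>k' / q - v h\<close>; the chain rule on the bundle then gives the integrand.\<close>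

lemma first_variation:
  fixes q k :: "real \<Rightarrow> real ^ 'n::finite"
  assumes L: "smooth_lagrangian L" and q: "smooth_curve q" and ext: "extremal L q"
    and k: "smooth_map_on {0..1} k" "\<And>t. t \<in> {0..1} \<Longrightarrow> (\<Sum>x\<in>UNIV. k t $ x) = 0"
      "k 0 = 0" "k 1 = 0"
    and k': "\<And>t. t \<in> {0..1} \<Longrightarrow> (k has_vector_derivative k' t) (at t within {0..1})"
      "continuous_on {0..1} k'"
  shows "integral {0..1} (\<lambda>t. let v = velocity q t; h = score (q t) (k t) in
      pairing (q t) (nat_grad L (q t) v t) h +
      pairing (q t) (fiber_grad L (q t) v t)
        (score (q t) (k' t) - v * h + mean (q t) (v * h) *\<^sub>R 1)) = 0"
proof -
  let ?I = "{0..1::real}"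
  have qd: "q t \<in> densities" if "t \<in> ?I" for t using q that by (simp add: smooth_curve_def)
  have qs: "smooth_map_on ?I q" using q by (simp add: smooth_curve_def)
  obtain q' where q': "\<And>t. t \<in> ?I \<Longrightarrow> (q has_vector_derivative q' t) (at t within ?I)"
    "continuous_on ?I q'"
    using smooth_curve_has_vector_derivative[OF qs] by metis
  note cont = smooth_map_on_continuous_on[OF qs] smooth_map_on_continuous_on[OF k(1)] q'(2) k'(2)
  have "continuous_on ?I (\<lambda>t. \<Sum>x\<in>UNIV. \<bar>k t $ x\<bar> / q t $ x)"
    by (intro continuous_intros cont) (use qd densityD(2) in blast)
  from compact_imp_bounded[OF compact_continuous_image[OF this compact_Icc]]
  obtain B where B: "B > 0" "\<forall>t\<in>?I. \<bar>\<Sum>x\<in>UNIV. \<bar>k t $ x\<bar> / q t $ x\<bar> \<le> B"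
    unfolding bounded_pos by auto
  \<comment> \<open>The bound on \<open>\<bar>k\<bar> / q\<close> gives a radius within which \<open>q + s k\<close> stays positive.\<close>
  define \<epsilon> where "\<epsilon> = 1 / B"
  have \<epsilon>: "\<epsilon> > 0" using B(1) by (simp add: \<epsilon>_def)
  let ?J = "{-\<epsilon><..<\<epsilon>}"
  define H where "H = (\<lambda>s t. q t + s *\<^sub>R k t)"
  define H' where "H' = (\<lambda>s t. q' t + s *\<^sub>R k' t)"
  define V where "V = (\<lambda>s t. score (H s t) (H' s t))"
  have Hd: "H s t \<in> densities" if s: "s \<in> ?J" and t: "t \<in> ?I" for s t
  proof -
    have "0 < q t $ x + s * k t $ x" for x
    proof -
      have qx: "0 < q t $ x" by (rule densityD(1)[OF qd[OF t]])
      have "\<bar>k t $ x\<bar> / q t $ x \<le> (\<Sum>x\<in>UNIV. \<bar>k t $ x\<bar> / q t $ x)"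
        by (rule member_le_sum) (auto simp: less_imp_le densityD(1)[OF qd[OF t]])
      also have "\<dots> \<le> B" using B(2) t by (meson abs_le_D1)
      finally have "\<bar>k t $ x\<bar> \<le> B * q t $ x" using qx by (simp add: divide_le_eq)
      moreover have "\<bar>s\<bar> * B < 1" using s B(1) by (auto simp: \<epsilon>_def field_simps abs_if)
      ultimately have "\<bar>s\<bar> * \<bar>k t $ x\<bar> \<le> \<bar>s\<bar> * (B * q t $ x)" "(\<bar>s\<bar> * B) * q t $ x < 1 * q t $ x"
        using qx by (auto intro!: mult_left_mono mult_strict_right_mono)
      then have "\<bar>s * k t $ x\<bar> < q t $ x" by (simp add: abs_mult mult.assoc)
      then show ?thesis by linarith
    qed
    then show ?thesis
      using densityD(3)[OF qd[OF t]] k(2)[OF t]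
      by (simp add: densities_def H_def sum.distrib sum_distrib_left[symmetric])
  qed
  have H': "(H s has_vector_derivative H' s t) (at t within ?I)" if "t \<in> ?I" for s t
    unfolding H_def H'_def using q'(1)[OF that] k'(1)[OF that]
    by (auto intro!: derivative_eq_intros)
  have vel: "velocity (H s) t = V s t" if "s \<in> ?J" "t \<in> ?I" for s t
    unfolding V_def using that Hd by (intro velocity_eq H') auto
  have in_bundle: "(H s t, V s t) \<in> stat_bundle" if s: "s \<in> ?J" and t: "t \<in> ?I" for s t
    using velocity_in_bundle[OF H'[OF t] t Hd[OF s]] by (simp add: vel[OF s t])
  have "smooth_variation \<epsilon> H q"
    unfolding smooth_variation_def
  proof (intro conjI ballI)
    have snd: "smooth_map_on (?J \<times> ?I) (\<lambda>z. f (snd z))" if "smooth_map_on ?I f"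
      for f :: "real \<Rightarrow> real ^ 'n"
      by (rule smooth_map_on_compose_linear[OF bounded_linear_snd that]) auto
    show "smooth_map_on (?J \<times> ?I) (\<lambda>(s, t). H s t)"
      unfolding H_def case_prod_beta
      by (intro smooth_map_on_add smooth_map_on_bilinear[OF bounded_bilinear_scaleR] snd
          qs k(1) smooth_map_on_linear bounded_linear_fst)
  qed (use Hd k in \<open>auto simp: H_def\<close>)
  then have stationary: "((\<lambda>s. action L (H s)) has_real_derivative 0) (at 0)"
    using ext \<epsilon> unfolding extremal_def by blast
  define dL where "dL = (\<lambda>s t. let v = V s t; h = score (H s t) (k t) in
      pairing (H s t) (nat_grad L (H s t) v t) h +
      pairing (H s t) (fiber_grad L (H s t) v t)
        (score (H s t) (k' t) - v * h + mean (H s t) (v * h) *\<^sub>R 1))"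
  have der: "((\<lambda>s. L (H s t) (V s t) t) has_real_derivative dL s t) (at s)"
    if s: "s \<in> ?J" and t: "t \<in> ?I" for s t
  proof -
    have dH: "((\<lambda>s. H s t) has_derivative (\<lambda>r. r *\<^sub>R k t)) (at s)"
      unfolding H_def by (auto intro!: derivative_eq_intros)
    have "((\<lambda>s. V s t) has_vector_derivative
        (score (H s t) (k' t) - V s t * score (H s t) (k t))) (at s)"
    proof -
      have "((\<lambda>s. (q' t $ x + s * k' t $ x) / (q t $ x + s * k t $ x)) has_real_derivative
          (score (H s t) (k' t) - V s t * score (H s t) (k t)) $ x) (at s)" for x
      proof -
        \<comment> \<open>The quotient rule in the form that exhibits the velocity \<open>a / b\<close>.\<close>
        have quotient: "(a' * b - a * b') / (b * b) = a' / b - a / b * (b' / b)" if "b \<noteq> 0"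
          for a a' b b' :: real using that by (simp add: field_simps)
        have "((\<lambda>s. (q' t $ x + s * k' t $ x) / (q t $ x + s * k t $ x)) has_real_derivative
          (k' t $ x * (H s t $ x) - (H' s t $ x) * k t $ x) / (H s t $ x * H s t $ x)) (at s)"
          using densityD(2)[OF Hd[OF s t], of x]
          by (auto intro!: derivative_eq_intros simp: H_def H'_def)
        then show ?thesis
          unfolding quotient[OF densityD(2)[OF Hd[OF s t], of x]] by (simp add: V_def score_def)
      qed
      then show ?thesis
        by (simp add: has_vector_derivative_vec has_real_derivative_iff_has_vector_derivative
            V_def H_def H'_def score_def)
    qed
    then have dV: "((\<lambda>s. V s t) has_derivative
        (\<lambda>r. r *\<^sub>R (score (H s t) (k' t) - V s t * score (H s t) (k t)))) (at s)"
      by (simp add: has_vector_derivative_def)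
    let ?h = "score (H s t) (k t)"
    let ?d = "score (H s t) (k' t) - V s t * ?h"
    have scale: "r *\<^sub>R ?d + mean (H s t) (V s t * score (H s t) (r *\<^sub>R k t)) *\<^sub>R 1 =
        r *\<^sub>R (?d + mean (H s t) (V s t * ?h) *\<^sub>R 1)" for r
      by (simp add: score_scaleR mean_simps scaleR_add_right)
    have "((\<lambda>s. L (H s t) (V s t) t) has_derivative (\<lambda>r. r * dL s t)) (at s)"
      using lagrangian_chain_rule[OF L t dH dV _ s in_bundle[OF _ t]]
      unfolding scale unfolding score_scaleR pairing_scaleR dL_def Let_def distrib_left by simp
    then show ?thesis by (simp add: has_field_derivative_def mult_commute_abs)
  qed
  let ?P = "?J \<times> ?I"
  have cH: "continuous_on ?P (\<lambda>z. H (fst z) (snd z))"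
    and cH': "continuous_on ?P (\<lambda>z. H' (fst z) (snd z))"
    and ck: "continuous_on ?P (\<lambda>z. k (snd z))" and ck': "continuous_on ?P (\<lambda>z. k' (snd z))"
    unfolding H_def H'_def
    by (intro continuous_intros cont[THEN continuous_on_compose2]; force)+
  have cV: "continuous_on ?P (\<lambda>z. V (fst z) (snd z))"
    unfolding V_def by (intro continuous_intros cH cH') (use Hd in auto)
  have c_bundle: "continuous_on ?P (\<lambda>z. f (H (fst z) (snd z)) (V (fst z) (snd z)) (snd z))"
    if "continuous_on (stat_bundle \<times> ?I) (\<lambda>((q, w), t). f q w t)"
    for f :: "real ^ 'n \<Rightarrow> real ^ 'n \<Rightarrow> real \<Rightarrow> 'b::topological_space"
  proof -
    have "continuous_on ?P (\<lambda>z. (\<lambda>((q, w), t). f q w t)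
        ((H (fst z) (snd z), V (fst z) (snd z)), snd z))"
      by (rule continuous_on_compose2[OF that]) (use in_bundle in \<open>auto intro!: continuous_intros cH cV\<close>)
    then show ?thesis by simp
  qed
  have cdL: "continuous_on ?P (\<lambda>(s, t). dL s t)"
    unfolding dL_def Let_def case_prod_beta
    by (intro continuous_intros cH ck ck' cV c_bundle[OF continuous_on_gradients(1)[OF L]]
        c_bundle[OF continuous_on_gradients(2)[OF L]]) (use Hd in auto)
  have int: "(\<lambda>t. L (H s t) (V s t) t) integrable_on ?I" if s: "s \<in> ?J" for s
  proof (rule integrable_continuous_real)
    have cL: "continuous_on (stat_bundle \<times> ?I) (\<lambda>((q, w), t). L q w t)"
      using L smooth_map_on_continuous_on unfolding smooth_lagrangian_def by blast
    show "continuous_on ?I (\<lambda>t. L (H s t) (V s t) t)"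
    proof -
      have "continuous_on ?I (\<lambda>t. (s, t))" "(\<lambda>t. (s, t)) ` ?I \<subseteq> ?P"
        using s by (auto intro!: continuous_intros)
      from continuous_on_compose2[OF c_bundle[OF cL] this] show ?thesis by simp
    qed
  qed
  have "((\<lambda>s. integral ?I (\<lambda>t. L (H s t) (V s t) t)) has_real_derivative integral ?I (dL 0)) (at 0)"
    by (rule differentiate_integral[OF der int cdL \<epsilon>])
  then have "((\<lambda>s. action L (H s)) has_real_derivative integral ?I (dL 0)) (at 0)"
    by (rule has_field_derivative_transform_within_open[where S = ?J])
      (use \<epsilon> vel in \<open>auto simp: action_def intro!: integral_cong\<close>)
  with stationary have "integral ?I (dL 0) = 0" by (rule DERIV_unique[symmetric])
  moreover have "integral ?I (dL 0) = integral ?I (\<lambda>t. let v = velocity q t; h = score (q t) (k t) in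
      pairing (q t) (nat_grad L (q t) v t) h +
      pairing (q t) (fiber_grad L (q t) v t)
        (score (q t) (k' t) - v * h + mean (q t) (v * h) *\<^sub>R 1))"
  proof (rule integral_cong)
    fix t assume t: "t \<in> ?I"
    have H0: "H 0 = q" by (simp add: H_def)
    then show "dL 0 t = (let v = velocity q t; h = score (q t) (k t) in
      pairing (q t) (nat_grad L (q t) v t) h +
      pairing (q t) (fiber_grad L (q t) v t)
        (score (q t) (k' t) - v * h + mean (q t) (v * h) *\<^sub>R 1))"
      using vel[of 0 t] t \<epsilon> by (simp add: dL_def)
  qed
  ultimately show ?thesis by simp
qed

section \<open>The Euler-Lagrange equation\<close>

text \<open>The variation field is \<open>k = \<phi> q (a - E[a])\<close>, that is \<open>h = \<phi> (a - E[a])\<close>. The terms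
  with \<open>q'\<close> in the vertical part \<open>\<beta>\<close> of the variation cancel, leaving \<open>\<phi>' (a - E[a])\<close>; centering \<open>a\<close>
  is invisible to gradients, which lie in the fiber.\<close>

lemma euler_lagrange_weak:
  fixes q :: "real \<Rightarrow> real ^ 'n::finite"
  assumes L: "smooth_lagrangian L" and q: "smooth_curve q" and ext: "extremal L q"
    and \<phi>: "real_polynomial_function \<phi>" "\<And>t. (\<phi> has_real_derivative \<phi>' t) (at t)"
      "\<phi> 0 = 0" "\<phi> 1 = 0" and c\<phi>': "continuous_on {0..1} \<phi>'"
  shows "integral {0..1} (\<lambda>t. \<phi> t * pairing (q t) (nat_grad L (q t) (velocity q t) t) a +
    \<phi>' t * pairing (q t) (fiber_grad L (q t) (velocity q t) t) a) = 0"
proof -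
  let ?I = "{0..1::real}"
  have qd: "q t \<in> densities" if "t \<in> ?I" for t using q that by (simp add: smooth_curve_def)
  have qs: "smooth_map_on ?I q" using q by (simp add: smooth_curve_def)
  obtain q' where q': "\<And>t. t \<in> ?I \<Longrightarrow> (q has_vector_derivative q' t) (at t within ?I)"
    "continuous_on ?I q'"
    using smooth_curve_has_vector_derivative[OF qs] by metis
  define c where "c = (\<lambda>t. exp_transport (q t) (q t) a)"
  \<comment> \<open>\<open>b q = q (a - E[a])\<close>, expanded so that it is visibly built from linear maps and products.\<close>
  define b where "b = (\<lambda>q. q * a + (-1) *\<^sub>R (mean q a *\<^sub>R q))"
  have b: "b (q t) = q t * c t" for t
    by (simp add: b_def c_def exp_transport_eq algebra_simps)
  define b' where "b' = (\<lambda>t. q' t * a + (-1) *\<^sub>R (mean (q t) a *\<^sub>R q' t + mean (q' t) a *\<^sub>R q t))"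
  have db: "((\<lambda>t. b (q t)) has_vector_derivative b' t) (at t within ?I)" if t: "t \<in> ?I" for t
  proof -
    note q't = q'(1)[OF t]
    have m: "((\<lambda>t. mean (q t) a) has_vector_derivative mean (q' t) a) (at t within ?I)"
      by (rule bounded_linear.has_vector_derivative[OF mean_linear(2) q't])
    have "((\<lambda>t. q t * a) has_vector_derivative q' t * a) (at t within ?I)"
      by (rule bounded_linear.has_vector_derivative[OF
            bounded_bilinear.bounded_linear_left[OF bounded_bilinear_vec_times] q't])
    moreover have "((\<lambda>t. mean (q t) a *\<^sub>R q t) has_vector_derivative
        mean (q t) a *\<^sub>R q' t + mean (q' t) a *\<^sub>R q t) (at t within ?I)"
      by (rule has_vector_derivative_scaleR[OF m[folded has_real_derivative_iff_has_vector_derivative] q't])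
    ultimately show ?thesis
      unfolding b_def b'_def
      by (intro has_vector_derivative_add
          bounded_linear.has_vector_derivative[OF bounded_linear_scaleR_right])
  qed
  have sb: "smooth_map_on ?I (\<lambda>t. b (q t))"
  proof -
    have "smooth_map_on ?I (\<lambda>t. mean (q t) a)"
      by (rule smooth_map_on_bilinear[OF bounded_bilinear_mean qs smooth_map_on_const])
    then show ?thesis
      unfolding b_def
      by (intro smooth_map_on_add smooth_map_on_bilinear[OF bounded_bilinear_scaleR]
          smooth_map_on_bilinear[OF bounded_bilinear_vec_times] smooth_map_on_const qs)
  qed
  define k where "k = (\<lambda>t. \<phi> t *\<^sub>R b (q t))"
  define k' where "k' = (\<lambda>t. \<phi> t *\<^sub>R b' t + \<phi>' t *\<^sub>R b (q t))"
  have mean_c: "mean (q t) (c t) = 0" if "t \<in> ?I" for t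
    using exp_transport_in_fiber[OF qd[OF that]] by (simp add: c_def fiber_def)
  have sum_k: "(\<Sum>x\<in>UNIV. k t $ x) = 0" if "t \<in> ?I" for t
    using mean_c[OF that]
    by (simp add: k_def b mean_def sum_distrib_left[symmetric] mult.commute[of "q t $ _"])
  have smooth_k: "smooth_map_on ?I k"
    unfolding k_def
    by (intro smooth_map_on_bilinear[OF bounded_bilinear_scaleR] sb smooth_map_on_polynomial \<phi>(1))
  have dk: "(k has_vector_derivative k' t) (at t within ?I)" if t: "t \<in> ?I" for t
    unfolding k_def k'_def
    by (rule has_vector_derivative_scaleR[OF has_field_derivative_at_within[OF \<phi>(2)] db[OF t]])
  have ck': "continuous_on ?I k'"
    unfolding k'_def b_def b'_def
    by (intro continuous_intros c\<phi>' q'(2) smooth_map_on_continuous_on[OF qs]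
        smooth_map_on_continuous_on[OF smooth_map_on_polynomial[OF \<phi>(1)]])
  have "integral ?I (\<lambda>t. \<phi> t * pairing (q t) (nat_grad L (q t) (velocity q t) t) a +
      \<phi>' t * pairing (q t) (fiber_grad L (q t) (velocity q t) t) a) =
    integral ?I (\<lambda>t. let v = velocity q t; h = score (q t) (k t) in
      pairing (q t) (nat_grad L (q t) v t) h +
      pairing (q t) (fiber_grad L (q t) v t)
        (score (q t) (k' t) - v * h + mean (q t) (v * h) *\<^sub>R 1))"
  proof (rule integral_cong)
    fix t assume t: "t \<in> ?I"
    note qt = qd[OF t]
    let ?v = "velocity q t" and ?h = "score (q t) (k t)"
    have v: "?v = score (q t) (q' t)" by (rule velocity_eq[OF q'(1)[OF t] t qt])
    have h: "?h = \<phi> t *\<^sub>R c t"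
      using densityD(2)[OF qt] by (simp add: k_def b score_def vec_eq_iff)
    have "mean (q t) (?v * c t) = mean (q' t) (c t)"
      using mean_score[OF qt, of "c t" "q' t"] by (simp add: v mult.commute)
    also have "\<dots> = mean (q' t) a"
    proof -
      have "(\<Sum>x\<in>UNIV. q' t $ x) = 0"
        by (rule sum_derivative_zero[OF q'(1)[OF t] t]) (rule densityD(3)[OF qd])
      then have "mean (q' t) 1 = 0" by (simp add: mean_def)
      then show ?thesis by (simp add: c_def exp_transport_eq mean_simps)
    qed
    finally have mv: "mean (q t) (?v * (\<phi> t *\<^sub>R c t)) = \<phi> t * mean (q' t) a"
      by (simp add: mean_simps)
    have \<beta>: "score (q t) (k' t) - ?v * ?h + mean (q t) (?v * ?h) *\<^sub>R 1 = \<phi>' t *\<^sub>R c t"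
      unfolding h mv using densityD(2)[OF qt]
      by (simp add: vec_eq_iff k'_def b b'_def v score_def c_def exp_transport_eq field_simps)
    have in_bundle: "(q t, ?v) \<in> stat_bundle"
      by (rule velocity_in_bundle[OF q'(1)[OF t] t qd])
    have pair_c: "pairing (q t) g (c t) = pairing (q t) g a" if "g \<in> fiber (q t)" for g
      using that by (simp add: c_def pairing_def exp_transport_eq right_diff_distrib mean_simps fiber_def)
    show "\<phi> t * pairing (q t) (nat_grad L (q t) ?v t) a + \<phi>' t * pairing (q t) (fiber_grad L (q t) ?v t) a =
      (let v = ?v; h = ?h in
      pairing (q t) (nat_grad L (q t) v t) h +
      pairing (q t) (fiber_grad L (q t) v t)
        (score (q t) (k' t) - v * h + mean (q t) (v * h) *\<^sub>R 1))"
      unfolding Let_def \<beta> unfolding h pairing_scaleR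
      using pair_c gradients_in_fiber[OF L in_bundle t] by simp
  qed
  also have "\<dots> = 0"
    by (rule first_variation[OF L q ext smooth_k sum_k _ _ dk ck']) (simp_all add: k_def \<phi>)
  finally show ?thesis .
qed

lemma gradients_along_curve_continuous:
  fixes q :: "real \<Rightarrow> real ^ 'n::finite"
  assumes L: "smooth_lagrangian L" and q: "smooth_curve q"
  shows "continuous_on {0..1} (\<lambda>t. fiber_grad L (q t) (velocity q t) t)"
    and "continuous_on {0..1} (\<lambda>t. nat_grad L (q t) (velocity q t) t)"
proof -
  let ?I = "{0..1::real}"
  have qd: "q t \<in> densities" if "t \<in> ?I" for t using q that by (simp add: smooth_curve_def)
  have qs: "smooth_map_on ?I q" using q by (simp add: smooth_curve_def)
  obtain q' where q': "\<And>t. t \<in> ?I \<Longrightarrow> (q has_vector_derivative q' t) (at t within ?I)"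
    "continuous_on ?I q'"
    using smooth_curve_has_vector_derivative[OF qs] by metis
  have "continuous_on ?I (\<lambda>t. score (q t) (q' t))"
    by (intro continuous_intros smooth_map_on_continuous_on[OF qs] q'(2) qd)
  then have cv: "continuous_on ?I (velocity q)"
    by (rule continuous_on_eq) (use velocity_eq[OF q'(1) _ qd] in auto)
  have lift: "continuous_on ?I (\<lambda>t. ((q t, velocity q t), t))"
    by (intro continuous_intros smooth_map_on_continuous_on[OF qs] cv)
  have img: "(\<lambda>t. ((q t, velocity q t), t)) ` ?I \<subseteq> stat_bundle \<times> ?I"
    using velocity_in_bundle[OF q'(1) _ qd] by auto
  show "continuous_on ?I (\<lambda>t. fiber_grad L (q t) (velocity q t) t)"
    using continuous_on_compose2[OF continuous_on_gradients(1)[OF L] lift img] by simp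
  show "continuous_on ?I (\<lambda>t. nat_grad L (q t) (velocity q t) t)"
    using continuous_on_compose2[OF continuous_on_gradients(2)[OF L] lift img] by simp
qed

theorem proposition5p1:
  fixes L :: "real ^ 'n::finite \<Rightarrow> real ^ 'n \<Rightarrow> real \<Rightarrow> real"
    and q :: "real \<Rightarrow> real ^ 'n"
  assumes "smooth_lagrangian L"
    and "smooth_curve q"
    and "extremal L q"
  shows "\<forall>t\<in>{0..1}.
    mix_cov_deriv q (\<lambda>t. fiber_grad L (q t) (velocity q t) t) t = nat_grad L (q t) (velocity q t) t"
proof
  let ?I = "{0..1::real}"
  fix t assume t: "t \<in> ?I"
  define \<eta> where "\<eta> = (\<lambda>t. fiber_grad L (q t) (velocity q t) t)"
  define g where "g = (\<lambda>t. nat_grad L (q t) (velocity q t) t)"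
  have qd: "q t \<in> densities" if "t \<in> ?I" for t using assms(2) that by (simp add: smooth_curve_def)
  have qs: "smooth_map_on ?I q" using assms(2) by (simp add: smooth_curve_def)
  obtain q' where q': "\<And>t. t \<in> ?I \<Longrightarrow> (q has_vector_derivative q' t) (at t within ?I)"
    using smooth_curve_has_vector_derivative[OF qs] by metis
  note cont = gradients_along_curve_continuous[OF assms(1,2), folded \<eta>_def g_def]
    smooth_map_on_continuous_on[OF qs]
  have v: "velocity q t = score (q t) (q' t)"
    by (rule velocity_eq[OF q'[OF t] t qd[OF t]])
  have momentum: "((\<lambda>t. pairing (q t) (\<eta> t) a) has_real_derivative pairing (q t) (g t) a) (at t within ?I)" for a
  proof (rule weak_derivative_imp_derivative[OF _ _ _ t])
    show "continuous_on ?I (\<lambda>t. pairing (q t) (\<eta> t) a)" "continuous_on ?I (\<lambda>t. pairing (q t) (g t) a)"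
      by (intro continuous_intros cont)+
    show "integral ?I (\<lambda>t. \<phi> t * pairing (q t) (g t) a + \<phi>' t * pairing (q t) (\<eta> t) a) = 0"
      if "real_polynomial_function \<phi>" "real_polynomial_function \<phi>'"
        "\<And>t. (\<phi> has_real_derivative \<phi>' t) (at t)" "\<phi> 0 = 0" "\<phi> 1 = 0" for \<phi> \<phi>'
      using euler_lagrange_weak[OF assms that(1,3,4,5) smooth_map_on_continuous_on[OF smooth_map_on_polynomial[OF that(2)]]]
      by (simp add: \<eta>_def g_def)
  qed
  have pairing_axis: "pairing q \<zeta> (axis x 1) = \<zeta> $ x * q $ x / real CARD('n)" for q \<zeta> :: "real ^ 'n" and x
    by (simp add: pairing_def mean_def axis_def if_distrib[of "\<lambda>y. _ * y"] if_distrib[of "\<lambda>y. y * _"] cong: if_cong)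
  \<comment> \<open>The covariant term \<open>v \<eta>\<close> comes from dividing the density \<open>q\<close> out of the pairing.\<close>
  have "((\<lambda>t. \<eta> t $ x) has_real_derivative (g t - velocity q t * \<eta> t) $ x) (at t within ?I)" for x
  proof -
    have dq: "((\<lambda>t. q t $ x) has_real_derivative q' t $ x) (at t within ?I)"
      using q'[OF t] by (simp add: has_vector_derivative_vec has_real_derivative_iff_has_vector_derivative)
    note nz = densityD(2)[OF qd[OF t], of x]
    let ?P = "\<lambda>\<zeta>. pairing (q t) \<zeta> (axis x 1) * real CARD('n)"
    have "((\<lambda>t. pairing (q t) (\<eta> t) (axis x 1) * real CARD('n) / q t $ x) has_real_derivative
        (?P (g t) * q t $ x - ?P (\<eta> t) * q' t $ x) / (q t $ x * q t $ x)) (at t within ?I)"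
      by (rule DERIV_divide[OF DERIV_cmult_right[OF momentum] dq nz])
    moreover have "(?P (g t) * q t $ x - ?P (\<eta> t) * q' t $ x) / (q t $ x * q t $ x) =
        (g t - velocity q t * \<eta> t) $ x"
      using nz by (simp add: v score_def pairing_axis field_simps)
    moreover have "pairing (q s) (\<eta> s) (axis x 1) * real CARD('n) / q s $ x = \<eta> s $ x" if "s \<in> ?I" for s
      using densityD(2)[OF qd[OF that], of x] by (simp add: pairing_axis)
    ultimately show ?thesis
      using t by (auto intro: has_field_derivative_transform_within[where d = 1])
  qed
  then have "(\<eta> has_vector_derivative g t - velocity q t * \<eta> t) (at t within ?I)"
    by (simp add: has_vector_derivative_vec has_real_derivative_iff_has_vector_derivative)
  then have "vector_derivative \<eta> (at t within ?I) = g t - velocity q t * \<eta> t"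
    using t by (auto intro: vector_derivative_within_cbox[of 0 1, simplified])
  then show "mix_cov_deriv q (\<lambda>t. fiber_grad L (q t) (velocity q t) t) t = nat_grad L (q t) (velocity q t) t"
    by (simp add: mix_cov_deriv_def \<eta>_def[symmetric] g_def[symmetric])
       (simp add: g_def)
qed

end
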